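(* Let $H:\mathbb{T}^n\times\mathbb{R}^n\to\mathbb{R}$ be smooth, $\mathbb{Z}^n$-periodic in $x$, such that (i) $H(x,\cdot)$ is strictly convex for every $x$, and (ii) $\lim_{|p|\to\infty} H(x,p)/|p|=+\infty$. Let $P\in\mathbb{R}^n$. Then a Borel probability measure $\nu$ on $\mathbb{T}^n\times\mathbb{R}^n$ is a minimizer of $$\min_{\nu\in\mathcal{F}}\int_{\mathbb{T}^n\times\mathbb{R}^n}\big(L(x,v)+P\cdot v\big)\,d\nu(x,v)$$ if and only if the measure $\mu=\Phi_{\#}\nu$ satisfies: (a) $\int H(x,p)\,d\mu(x,p)=\overline{H}(P)$ and $H(x,p)=\overline{H}(P)$ for $\mu$-a.e. $(x,p)$; (b) $\int (p-P)\cdot D_pH(x,p)\,d\mu(x,p)=0$; (c) $\int D_pH(x,p)\cdot D\phi(x)\,d\mu(x,p)=0$ for every $\phi\in C^1(\mathbb{T}^n)$.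
   Context: $\mathbb{T}^n=\mathbb{R}^n/\mathbb{Z}^n$. The Lagrangian is $L(x,v)=\sup_{p\in\mathbb{R}^n}\{-p\cdot v-H(x,p)\}$, and $\Phi:\mathbb{T}^n\times\mathbb{R}^n\to\mathbb{T}^n\times\mathbb{R}^n$ is $\Phi(x,v)=(x,-D_vL(x,v))$; $\Phi_\#\nu$ denotes the push-forward of $\nu$ by $\Phi$. $\mathcal{F}$ is the set of holonomic measures: Borel probability measures $\nu$ on $\mathbb{T}^n\times\mathbb{R}^n$ with $\int v\cdot D\psi(x)\,d\nu(x,v)=0$ for every $\psi\in C^1(\mathbb{T}^n)$. $\overline{H}(P)$ is the unique real number such that $H(x,P+Du(x))=\overline{H}(P)$ admits a $\mathbb{Z}^n$-periodic viscosity solution $u$. *)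

theory Defs
  imports "HOL-Analysis.Analysis" "HOL-Probability.Probability"
begin

text \<open>Points of the torus T^n are represented by points of R^n = real^'n;
  functions on T^n are Z^n-periodic functions on R^n, and Borel probability
  measures on T^n x R^n are represented by Borel probability measures on
  R^n x R^n concentrated on [0,1)^n x R^n (the fundamental domain).\<close>

definition int_vec :: "real^'n \<Rightarrow> bool" where
  "int_vec k \<longleftrightarrow> (\<forall>i. k $ i \<in> \<int>)"

definition zn_periodic :: "(real^'n \<Rightarrow> 'b) \<Rightarrow> bool" where
  "zn_periodic f \<longleftrightarrow> (\<forall>x k. int_vec k \<longrightarrow> f (x + k) = f x)"

definition fund_dom :: "(real^'n) set" where
  "fund_dom = {x. \<forall>i. 0 \<le> x $ i \<and> x $ i < 1}"

definition torus_prob_measure :: "((real^'n) \<times> (real^'n)) measure \<Rightarrow> bool" where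
  "torus_prob_measure \<nu> \<longleftrightarrow> prob_space \<nu> \<and> sets \<nu> = sets borel \<and>
     emeasure \<nu> (- (fund_dom \<times> UNIV)) = 0"

definition grad :: "('a::euclidean_space \<Rightarrow> real) \<Rightarrow> 'a \<Rightarrow> 'a" where
  "grad f y = (SOME g. (f has_derivative (\<lambda>w. g \<bullet> w)) (at y))"

definition C1_fun :: "('a::euclidean_space \<Rightarrow> real) \<Rightarrow> bool" where
  "C1_fun f \<longleftrightarrow> (\<exists>g. (\<forall>x. (f has_derivative (\<lambda>w. g x \<bullet> w)) (at x)) \<and> continuous_on UNIV g)"

coinductive smooth_fun :: "('a::euclidean_space \<Rightarrow> real) \<Rightarrow> bool" where
  "continuous_on UNIV f \<Longrightarrow> f differentiable_on UNIV \<Longrightarrow>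
   (\<And>u. smooth_fun (\<lambda>x. frechet_derivative f (at x) u)) \<Longrightarrow> smooth_fun f"

definition strictly_convex :: "('a::real_vector \<Rightarrow> real) \<Rightarrow> bool" where
  "strictly_convex f \<longleftrightarrow> (\<forall>x y t. x \<noteq> y \<and> 0 < t \<and> t < 1 \<longrightarrow>
      f ((1 - t) *\<^sub>R x + t *\<^sub>R y) < (1 - t) * f x + t * f y)"

definition Lagr :: "(real^'n \<Rightarrow> real^'n \<Rightarrow> real) \<Rightarrow> real^'n \<Rightarrow> real^'n \<Rightarrow> real" where
  "Lagr H x v = (SUP p. - (p \<bullet> v) - H x p)"

definition Phi :: "(real^'n \<Rightarrow> real^'n \<Rightarrow> real) \<Rightarrow> (real^'n) \<times> (real^'n) \<Rightarrow> (real^'n) \<times> (real^'n)" where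
  "Phi H = (\<lambda>(x, v). (x, - grad (Lagr H x) v))"

definition holonomic :: "((real^'n) \<times> (real^'n)) measure set" where
  "holonomic = {\<nu>. torus_prob_measure \<nu> \<and>
     (\<forall>\<psi>::real^'n \<Rightarrow> real. C1_fun \<psi> \<and> zn_periodic \<psi> \<longrightarrow>
        has_bochner_integral \<nu> (\<lambda>(x, v). v \<bullet> grad \<psi> x) 0)}"

definition ereal_integral :: "'a measure \<Rightarrow> ('a \<Rightarrow> real) \<Rightarrow> ereal" where
  "ereal_integral M f =
     enn2ereal (\<integral>\<^sup>+ z. ennreal (max (f z) 0) \<partial>M) - enn2ereal (\<integral>\<^sup>+ z. ennreal (max (- f z) 0) \<partial>M)"

definition action :: "(real^'n \<Rightarrow> real^'n \<Rightarrow> real) \<Rightarrow> real^'n \<Rightarrow> ((real^'n) \<times> (real^'n)) measure \<Rightarrow> ereal" where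
  "action H P \<nu> = ereal_integral \<nu> (\<lambda>(x, v). Lagr H x v + P \<bullet> v)"

definition is_minimizer :: "(real^'n \<Rightarrow> real^'n \<Rightarrow> real) \<Rightarrow> real^'n \<Rightarrow> ((real^'n) \<times> (real^'n)) measure \<Rightarrow> bool" where
  "is_minimizer H P \<nu> \<longleftrightarrow> \<nu> \<in> holonomic \<and> (\<forall>\<nu>' \<in> holonomic. action H P \<nu> \<le> action H P \<nu>')"

definition visc_sub :: "(real^'n \<Rightarrow> real^'n \<Rightarrow> real) \<Rightarrow> real^'n \<Rightarrow> real \<Rightarrow> (real^'n \<Rightarrow> real) \<Rightarrow> bool" where
  "visc_sub H P c u \<longleftrightarrow> (\<forall>\<phi> x0. C1_fun \<phi> \<and>
      (\<exists>e>0. \<forall>y. dist y x0 < e \<longrightarrow> u y - \<phi> y \<le> u x0 - \<phi> x0) \<longrightarrow>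
      H x0 (P + grad \<phi> x0) \<le> c)"

definition visc_super :: "(real^'n \<Rightarrow> real^'n \<Rightarrow> real) \<Rightarrow> real^'n \<Rightarrow> real \<Rightarrow> (real^'n \<Rightarrow> real) \<Rightarrow> bool" where
  "visc_super H P c u \<longleftrightarrow> (\<forall>\<phi> x0. C1_fun \<phi> \<and>
      (\<exists>e>0. \<forall>y. dist y x0 < e \<longrightarrow> u y - \<phi> y \<ge> u x0 - \<phi> x0) \<longrightarrow>
      H x0 (P + grad \<phi> x0) \<ge> c)"

definition visc_sol :: "(real^'n \<Rightarrow> real^'n \<Rightarrow> real) \<Rightarrow> real^'n \<Rightarrow> real \<Rightarrow> (real^'n \<Rightarrow> real) \<Rightarrow> bool" where
  "visc_sol H P c u \<longleftrightarrow> continuous_on UNIV u \<and> visc_sub H P c u \<and> visc_super H P c u"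

definition Hbar :: "(real^'n \<Rightarrow> real^'n \<Rightarrow> real) \<Rightarrow> real^'n \<Rightarrow> real" where
  "Hbar H P = (THE c. \<exists>u. zn_periodic u \<and> visc_sol H P c u)"

end

theory Submission
  imports Defs
begin

text \<open>The critical value \<open>crit\<close> is the smallest \<open>a\<close> such that every closed curve on the torus
  of duration \<open>T\<close> has action at least \<open>- a * T\<close>. Minimizing the action plus \<open>crit\<close> times duration over curves of duration
  at least \<open>S\<close> and letting \<open>S\<close> tend to infinity gives a weak KAM solution, which is a
  viscosity solution at level \<open>crit\<close>; a doubling of variables shows that there is no other level, so
  \<open>Hbar H P = crit\<close>. Mollifying it gives \<open>C\<^sup>1\<close> functions \<open>w\<close> with \<open>H x (P + grad w x) \<le> crit + \<epsilon>\<close>.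
  By Fenchel's inequality, the action of a holonomic measure is at least \<open>- crit\<close>, and loops with nearly
  optimal mean action show that \<open>- crit\<close> is the infimum. For a minimizer
  the Fenchel gap of \<open>P + grad w\<close> is of mean at most \<open>\<epsilon>\<close>, so \<open>P + grad w\<close> converges to the optimal momentum
  almost everywhere; in the limit the energy is at most \<open>crit\<close> with mean \<open>crit\<close>, hence
  equal to \<open>crit\<close>. The converse is Fenchel's equality.\<close>

text \<open>Strict convexity alone allows a degenerate second derivative of \<open>H\<close>, so the
  Lagrangian may be no better than C^1 in the velocity. Minimizing curves and their regularity are
  therefore avoided: only infima over polygonal curves occur. The bridge from curves to
  \<open>H\<close> is Fenchel's equality at \<open>v = - DH x p\<close>, which turns an inequality
  along arbitrarily short segments in direction \<open>v\<close> into a bound on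
  \<open>H x p\<close>. The minus sign comes from the pairing \<open>- (p \<bullet> v)\<close> in
  the Lagrangian and fixes the orientation of all inequalities. A weak KAM solution is only
  Lipschitz, and a holonomic measure may charge points where it has no gradient; moreover holonomy
  can be tested only with C^1 functions. This forces the detour through C^1 approximate
  subsolutions. Nothing is known in advance about convergence of their gradients; it is obtained
  only almost everywhere for a given minimizer, because the Fenchel gap has a unique zero. Existence
  of a minimizer is never at stake: nearly optimal loops already fix the infimum.\<close>

lemma grad_eq:
  fixes f :: "'a::euclidean_space \<Rightarrow> real"
  assumes "(f has_derivative (\<lambda>w. g \<bullet> w)) (at y)"
  shows "grad f y = g"
proof -
  have "(f has_derivative (\<lambda>w. grad f y \<bullet> w)) (at y)"
    unfolding grad_def using assms by (rule someI)
  from has_derivative_unique[OF this assms] have "\<And>w. grad f y \<bullet> w = g \<bullet> w"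
    by meson
  then show ?thesis
    by (metis vector_eq_rdot)
qed

lemma C1_funD:
  assumes "C1_fun f"
  shows "(f has_derivative (\<lambda>w. grad f x \<bullet> w)) (at x)" "continuous_on UNIV (grad f)"
proof -
  obtain g where g: "\<And>x. (f has_derivative (\<lambda>w. g x \<bullet> w)) (at x)" "continuous_on UNIV g"
    using assms unfolding C1_fun_def by blast
  have "grad f = g" using grad_eq[OF g(1)] by auto
  with g show "(f has_derivative (\<lambda>w. grad f x \<bullet> w)) (at x)" "continuous_on UNIV (grad f)"
    by auto
qed

lemma C1_funI:
  assumes "\<And>x. (f has_derivative (\<lambda>w. g x \<bullet> w)) (at x)" "continuous_on UNIV g"
  shows "C1_fun f" "grad f = g"
  using assms grad_eq[OF assms(1)] unfolding C1_fun_def by auto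

lemma C1_fun_continuous: "C1_fun f \<Longrightarrow> continuous_on UNIV f"
  by (meson C1_funD(1) continuous_at_imp_continuous_on has_derivative_continuous)

lemma C1_fun_segment:
  assumes "C1_fun f"
  shows "((\<lambda>s. f (x + s *\<^sub>R v)) has_real_derivative grad f (x + s *\<^sub>R v) \<bullet> v) (at s within S)"
proof -
  have "((\<lambda>s. x + s *\<^sub>R v) has_derivative (\<lambda>h. h *\<^sub>R v)) (at s within S)"
    by (auto intro!: derivative_eq_intros)
  from has_derivative_compose[OF this C1_funD(1)[OF assms]]
  have "((\<lambda>s. f (x + s *\<^sub>R v)) has_derivative (\<lambda>h. grad f (x + s *\<^sub>R v) \<bullet> (h *\<^sub>R v))) (at s within S)" .
  then show ?thesis
    unfolding has_field_derivative_def
    by (rule has_derivative_eq_rhs) (auto simp: fun_eq_iff)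
qed

text \<open>The device for extracting gradient bounds from inequalities over short segments. With
  \<open>p = P + grad f x\<close>, \<open>v = - DH x p\<close> and \<open>b = LP x v + c\<close>,
  Fenchel's equality reads the conclusion as \<open>H x p \<le> c\<close>.\<close>

lemma C1_fun_slope_le:
  assumes "C1_fun f" "0 < d" "\<And>t. 0 < t \<Longrightarrow> t < d \<Longrightarrow> f x \<le> t * b + f (x + t *\<^sub>R v)"
  shows "- (grad f x \<bullet> v) \<le> b"
proof -
  have "((\<lambda>s. f (x + s *\<^sub>R v)) has_real_derivative grad f (x + 0 *\<^sub>R v) \<bullet> v) (at 0)"
    by (rule C1_fun_segment[OF assms(1)])
  then have lim: "((\<lambda>t. (f (x + t *\<^sub>R v) - f x) / t) \<longlongrightarrow> grad f x \<bullet> v) (at_right 0)"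
    unfolding has_field_derivative_iff by (simp add: filterlim_at_split)
  have "- b \<le> grad f x \<bullet> v"
  proof (rule tendsto_lowerbound[OF lim])
    show "\<forall>\<^sub>F t in at_right 0. - b \<le> (f (x + t *\<^sub>R v) - f x) / t"
    proof (rule eventually_at_rightI[OF _ assms(2)])
      fix t assume "t \<in> {0<..<d}"
      then show "- b \<le> (f (x + t *\<^sub>R v) - f x) / t" using assms(3)[of t] by (simp add: field_simps)
    qed
  qed simp
  then show ?thesis by simp
qed

subsection \<open>Periodic functions and the fundamental domain\<close>

lemma int_vec_simps [simp]: "int_vec 0" "int_vec (- k) \<longleftrightarrow> int_vec k"
  by (auto simp: int_vec_def minus_in_Ints_iff)

lemma int_vec_scale: "int_vec k \<Longrightarrow> int_vec (of_nat m *\<^sub>R k)"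
  by (auto simp: int_vec_def)

lemma zn_periodicD: "zn_periodic f \<Longrightarrow> int_vec k \<Longrightarrow> f (x + k) = f x"
  by (auto simp: zn_periodic_def)

definition torus_rep :: "real^'n \<Rightarrow> real^'n" where
  "torus_rep x = (\<chi> i. frac (x $ i))"

lemma torus_rep_in: "torus_rep x \<in> fund_dom"
  by (auto simp: torus_rep_def fund_dom_def frac_lt_1)

lemma int_vec_torus_rep: "int_vec (torus_rep x - x)"
  by (auto simp: torus_rep_def int_vec_def frac_def)

lemma zn_periodic_torus_rep: "zn_periodic f \<Longrightarrow> f (torus_rep x) = f x"
  using zn_periodicD[of f "torus_rep x - x" x] int_vec_torus_rep by force

lemma fund_dom_cbox: "fund_dom \<subseteq> cbox 0 (1 :: real^'n)"
proof
  fix x :: "real^'n" assume "x \<in> fund_dom"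
  then show "x \<in> cbox 0 1" by (simp add: fund_dom_def mem_box_cart less_imp_le)
qed

lemma torus_rep_measurable [measurable]: "torus_rep \<in> borel_measurable borel"
proof -
  have "(\<lambda>x::real^'n. \<chi> i. frac (x $ i)) \<in> borel_measurable borel"
  proof (rule borel_measurable_euclidean_space[THEN iffD2], intro ballI)
    fix b :: "real^'n" assume "b \<in> Basis"
    then obtain i where b: "b = axis i 1" by (auto simp: Basis_vec_def)
    have "(\<lambda>x::real^'n. frac (x $ i)) \<in> borel_measurable borel"
      unfolding frac_def by measurable
    then show "(\<lambda>x::real^'n. (\<chi> i. frac (x $ i)) \<bullet> b) \<in> borel_measurable borel"
      by (simp add: b inner_axis)
  qed
  then show ?thesis by (simp add: torus_rep_def[abs_def])
qed

lemma fund_dom_borel [measurable]: "fund_dom \<in> sets borel"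
proof -
  have "fund_dom = {x::real^'n. torus_rep x = x}"
    by (auto simp: fund_dom_def torus_rep_def vec_eq_iff frac_eq)
  also have "\<dots> \<in> sets borel" by measurable
  finally show ?thesis .
qed

lemma periodic_attains_sup:
  fixes f :: "real^'n \<Rightarrow> real"
  assumes "continuous_on UNIV f" "zn_periodic f"
  obtains x0 where "\<And>x. f x \<le> f x0"
proof -
  have "continuous_on (cbox 0 1) f" by (rule continuous_on_subset[OF assms(1)]) simp
  moreover have "cbox 0 (1::real^'n) \<noteq> {}" using fund_dom_cbox torus_rep_in by blast
  ultimately obtain x0 where x0: "\<And>x. x \<in> cbox 0 1 \<Longrightarrow> f x \<le> f x0"
    using continuous_attains_sup[OF compact_cbox] by metis
  have "f x \<le> f x0" for x
  proof -
    have "f (torus_rep x) \<le> f x0" by (rule x0) (use fund_dom_cbox torus_rep_in in blast)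
    then show ?thesis by (simp add: zn_periodic_torus_rep[OF assms(2)])
  qed
  then show ?thesis by (rule that)
qed

lemma periodic_continuous_bounded:
  fixes f :: "real^'n \<Rightarrow> real"
  assumes "continuous_on UNIV f" "zn_periodic f"
  obtains B where "\<And>x. \<bar>f x\<bar> \<le> B"
proof -
  have "continuous_on UNIV (\<lambda>x. \<bar>f x\<bar>)" by (intro continuous_intros assms)
  moreover have "zn_periodic (\<lambda>x. \<bar>f x\<bar>)" using assms(2) by (simp add: zn_periodic_def)
  ultimately show ?thesis using that by (rule periodic_attains_sup)
qed

lemma periodic_bounded:
  fixes f :: "real^'n \<Rightarrow> 'a::euclidean_space \<Rightarrow> real"
  assumes cont: "continuous_on UNIV (\<lambda>z. f (fst z) (snd z))"
    and per: "\<And>p. zn_periodic (\<lambda>x. f x p)"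
  obtains M where "\<And>x p. norm p \<le> R \<Longrightarrow> \<bar>f x p\<bar> \<le> M"
proof -
  have "compact ((\<lambda>z. f (fst z) (snd z)) ` (cbox 0 (1::real^'n) \<times> cball 0 R))"
    by (intro compact_continuous_image compact_Times compact_cbox compact_cball
        continuous_on_subset[OF cont]) auto
  then obtain M where M: "\<And>y. y \<in> (\<lambda>z. f (fst z) (snd z)) ` (cbox 0 (1::real^'n) \<times> cball 0 R) \<Longrightarrow> norm y \<le> M"
    by (meson bounded_iff compact_imp_bounded)
  have "\<bar>f x p\<bar> \<le> M" if "norm p \<le> R" for x p
  proof -
    have "\<bar>f (torus_rep x) p\<bar> \<le> M"
      using M[of "f (torus_rep x) p"] torus_rep_in[of x] fund_dom_cbox that by force
    then show ?thesis using zn_periodic_torus_rep[OF per[of p], of x] by simp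
  qed
  then show ?thesis using that by blast
qed

lemma periodic_equicontinuous:
  fixes f :: "real^'n \<Rightarrow> 'a::euclidean_space \<Rightarrow> real"
  assumes cont: "continuous_on UNIV (\<lambda>z. f (fst z) (snd z))"
    and per: "\<And>p. zn_periodic (\<lambda>x. f x p)" and e: "e > 0"
  obtains d where "d > 0" "\<And>x y p. norm p \<le> R \<Longrightarrow> dist x y < d \<Longrightarrow> \<bar>f x p - f y p\<bar> < e"
proof -
  \<comment> \<open>After \<open>x\<close> is translated into the unit box, every \<open>y\<close>
    at distance below 1 lies in this larger box; hence the cap \<open>min d 1\<close> below.\<close>
  let ?B = "cbox (-1) (2::real^'n) \<times> cball (0::'a) R"
  have "uniformly_continuous_on ?B (\<lambda>z. f (fst z) (snd z))"
    by (intro compact_uniformly_continuous compact_Times compact_cbox compact_cball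
        continuous_on_subset[OF cont]) auto
  then obtain d where d: "d > 0" "\<And>z z'. z \<in> ?B \<Longrightarrow> z' \<in> ?B \<Longrightarrow> dist z' z < d \<Longrightarrow>
      dist (f (fst z') (snd z')) (f (fst z) (snd z)) < e"
    unfolding uniformly_continuous_on_def using e by metis
  have "\<bar>f x p - f y p\<bar> < e" if p: "norm p \<le> R" and xy: "dist x y < min d 1" for x y p
  proof -
    define k where "k = torus_rep x - x"
    have k: "int_vec k" by (simp add: k_def int_vec_torus_rep)
    have x: "x + k \<in> cbox 0 1" using torus_rep_in[of x] fund_dom_cbox by (auto simp: k_def)
    have dxy: "dist (x + k) (y + k) = dist x y" by (simp add: dist_norm)
    have x01: "0 \<le> (x + k) $ i" "(x + k) $ i \<le> 1" for i
      using x by (auto simp: mem_box_cart)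
    have "- 1 \<le> (x + k) $ i \<and> (x + k) $ i \<le> 2" for i
      using x01[of i] by linarith
    then have x': "x + k \<in> cbox (-1) 2" unfolding mem_box_cart by simp
    have y': "y + k \<in> cbox (-1) 2"
    proof -
      have "- 1 \<le> (y + k) $ i \<and> (y + k) $ i \<le> 2" for i
      proof -
        have "\<bar>(x + k) $ i - (y + k) $ i\<bar> < 1"
          using component_le_norm_cart[of "(x + k) - (y + k)" i] xy dxy
          by (simp only: vector_minus_component dist_norm)
        then show ?thesis using x01[of i] by linarith
      qed
      then show ?thesis unfolding mem_box_cart by simp
    qed
    have "dist (f (x + k) p) (f (y + k) p) < e"
      using d(2)[of "(y + k, p)" "(x + k, p)"] x' y' p xy dxy by (auto simp: dist_Pair_Pair)
    then show ?thesis
      using zn_periodicD[OF per[of p] k] by (simp add: dist_real_def)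
  qed
  then show ?thesis using that[of "min d 1"] d(1) by auto
qed

subsection \<open>The Legendre transform\<close>

lemma smooth_funD:
  assumes "smooth_fun f"
  shows "continuous_on UNIV f" "(f has_derivative frechet_derivative f (at z)) (at z)"
    "continuous_on UNIV (\<lambda>x. frechet_derivative f (at x) u)"
proof -
  note a = assms[unfolded smooth_fun.simps[of f]]
  show "continuous_on UNIV f" using a by auto
  show "(f has_derivative frechet_derivative f (at z)) (at z)"
    using a by (auto simp: differentiable_on_def frechet_derivative_works)
  have "smooth_fun (\<lambda>x. frechet_derivative f (at x) u)" using a by auto
  then show "continuous_on UNIV (\<lambda>x. frechet_derivative f (at x) u)"
    by (rule smooth_fun.cases) simp
qed

lemma strictly_convex_tangent:
  fixes f :: "'a::euclidean_space \<Rightarrow> real"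
  assumes "strictly_convex f" "(f has_derivative (\<lambda>w. g \<bullet> w)) (at p)"
  shows "f p + g \<bullet> (q - p) \<le> f q" and "q \<noteq> p \<Longrightarrow> f p + g \<bullet> (q - p) < f q"
proof -
  have weak: "f p + g \<bullet> (r - p) \<le> f r" for r
  proof (cases "r = p")
    case False
    have "((\<lambda>t. f (p + t *\<^sub>R (r - p))) has_derivative (\<lambda>h. g \<bullet> (h *\<^sub>R (r - p)))) (at 0)"
      by (rule has_derivative_compose[of "\<lambda>t. p + t *\<^sub>R (r - p)" "\<lambda>h. h *\<^sub>R (r - p)" 0 UNIV f "\<lambda>w. g \<bullet> w"])
        (auto intro!: derivative_eq_intros assms(2))
    then have "((\<lambda>t. f (p + t *\<^sub>R (r - p))) has_real_derivative (g \<bullet> (r - p))) (at 0)"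
      unfolding has_field_derivative_def by (rule has_derivative_eq_rhs) (auto simp: fun_eq_iff)
    then have lim: "((\<lambda>t. (f (p + t *\<^sub>R (r - p)) - f p) / t) \<longlongrightarrow> g \<bullet> (r - p)) (at_right 0)"
      unfolding has_field_derivative_iff by (simp add: filterlim_at_split)
    have "g \<bullet> (r - p) \<le> f r - f p"
    proof (rule tendsto_upperbound[OF lim])
      show "\<forall>\<^sub>F t in at_right 0. (f (p + t *\<^sub>R (r - p)) - f p) / t \<le> f r - f p"
      proof (rule eventually_at_rightI[of 0 1])
        fix t :: real assume t: "t \<in> {0<..<1}"
        have "f ((1 - t) *\<^sub>R p + t *\<^sub>R r) < (1 - t) * f p + t * f r"
          using assms(1) t False unfolding strictly_convex_def by auto
        also have "(1 - t) *\<^sub>R p + t *\<^sub>R r = p + t *\<^sub>R (r - p)"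
          by (simp add: algebra_simps)
        finally show "(f (p + t *\<^sub>R (r - p)) - f p) / t \<le> f r - f p"
          using t by (simp add: field_simps)
      qed simp
    qed simp
    then show ?thesis by simp
  qed simp
  show "f p + g \<bullet> (q - p) \<le> f q" by (rule weak)
  assume ne: "q \<noteq> p"
  \<comment> \<open>Strictness is gained at the midpoint of \<open>p\<close> and \<open>q\<close>:
    the weak bound holds there, and strict convexity makes the next step strict.\<close>
  have "f p + g \<bullet> ((1/2) *\<^sub>R p + (1/2) *\<^sub>R q - p) \<le> f ((1/2) *\<^sub>R p + (1/2) *\<^sub>R q)"
    by (rule weak)
  also have "\<dots> < (1/2) * f p + (1/2) * f q"
    using assms(1)[unfolded strictly_convex_def, rule_format, of p q "1/2"] ne by auto
  also have "(1/2) *\<^sub>R p + (1/2) *\<^sub>R q - p = (1/2) *\<^sub>R (q - p)"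
    by (simp add: algebra_simps flip: scaleR_add_left)
  finally show "f p + g \<bullet> (q - p) < f q" by simp
qed

locale hamiltonian =
  fixes H :: "real^'n \<Rightarrow> real^'n \<Rightarrow> real"
  assumes smooth: "smooth_fun (\<lambda>z::(real^'n) \<times> (real^'n). H (fst z) (snd z))"
    and periodic: "\<And>p. zn_periodic (\<lambda>x. H x p)"
    and strict_conv: "\<And>x. strictly_convex (H x)"
    and superlinear: "\<And>x. filterlim (\<lambda>p. H x p / norm p) at_top at_infinity"
begin

lemma H_continuous: "continuous_on UNIV (\<lambda>z. H (fst z) (snd z))"
  by (rule smooth_funD[OF smooth])

lemma H_continuous_compose [continuous_intros]:
  "continuous_on S f \<Longrightarrow> continuous_on S g \<Longrightarrow> continuous_on S (\<lambda>s. H (f s) (g s))"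
  using continuous_on_compose2[OF H_continuous, of S "\<lambda>s. (f s, g s)"]
  by (auto intro!: continuous_intros)

text \<open>Assembled from partial derivatives because \<open>smooth_fun\<close> yields continuity
  of each directional derivative, which makes joint continuity in \<open>(x, p)\<close> immediate;
  \<open>grad\<close> is only a choice at each point.\<close>

definition DH :: "real^'n \<Rightarrow> real^'n \<Rightarrow> real^'n" where
  "DH x p = (\<Sum>i\<in>Basis. frechet_derivative (\<lambda>z. H (fst z) (snd z)) (at (x, p)) (0, i) *\<^sub>R i)"

lemma DH_has_derivative: "(H x has_derivative (\<lambda>w. DH x p \<bullet> w)) (at p)"
proof -
  let ?F = "\<lambda>z::(real^'n) \<times> (real^'n). H (fst z) (snd z)"
  let ?D = "frechet_derivative ?F (at (x, p))"
  have D: "(?F has_derivative ?D) (at (x, p))" by (rule smooth_funD[OF smooth])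
  have "((\<lambda>p. (x, p)) has_derivative (\<lambda>w. (0, w))) (at p)"
    by (auto intro!: derivative_eq_intros)
  from has_derivative_compose[OF this D] have der: "(H x has_derivative (\<lambda>w. ?D (0, w))) (at p)"
    by simp
  then have lin: "linear (\<lambda>w. ?D (0, w))" by (rule has_derivative_linear)
  have "?D (0, w) = DH x p \<bullet> w" for w
  proof -
    have "?D (0, w) = (\<lambda>w. ?D (0, w)) (\<Sum>i\<in>Basis. (w \<bullet> i) *\<^sub>R i)"
      by (simp add: euclidean_representation)
    also have "\<dots> = (\<Sum>i\<in>Basis. (w \<bullet> i) * ?D (0, i))"
      by (subst linear_sum[OF lin]) (simp add: linear_scale[OF lin])
    also have "\<dots> = DH x p \<bullet> w"
      unfolding DH_def by (simp add: inner_sum_right inner_commute mult.commute)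
    finally show ?thesis .
  qed
  with der show ?thesis by simp
qed

lemma grad_H: "grad (H x) p = DH x p"
  by (rule grad_eq[OF DH_has_derivative])

lemma DH_continuous: "continuous_on UNIV (\<lambda>z. DH (fst z) (snd z))"
  unfolding DH_def
  by (intro continuous_intros) (simp add: smooth_funD[OF smooth])

lemma DH_tangent: "H x p + DH x p \<bullet> (q - p) \<le> H x q"
  and DH_tangent_strict: "q \<noteq> p \<Longrightarrow> H x p + DH x p \<bullet> (q - p) < H x q"
  using strictly_convex_tangent[OF strict_conv DH_has_derivative] by auto

lemma DH_inj: "DH x p = DH x q \<Longrightarrow> p = q"
  using DH_tangent_strict[of q p x] DH_tangent_strict[of p q x]
  by (force simp: inner_diff_right)

lemma DH_surj: "\<exists>p. DH x p = - v"
proof -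
  let ?f = "\<lambda>p. H x p + p \<bullet> v"
  have "\<forall>\<^sub>F p in at_infinity. norm v + 1 \<le> H x p / norm p"
    using superlinear[of x] unfolding filterlim_at_top by blast
  then obtain b where b: "\<And>p. b \<le> norm p \<Longrightarrow> norm v + 1 \<le> H x p / norm p"
    unfolding eventually_at_infinity by blast
  \<comment> \<open>Beyond radius \<open>b\<close> superlinearity gives
    \<open>?f p \<ge> norm p\<close>, so for \<open>norm p \<ge> R\<close> the value is at least
    \<open>H x 0 = ?f 0\<close>. The 1 keeps \<open>norm p\<close> positive for clearing the
    denominator.\<close>
  define R where "R = max (max b 1) (H x 0)"
  have big: "?f 0 \<le> ?f p" if "R \<le> norm p" for p
  proof -
    have "R \<ge> 1" by (simp add: R_def)
    then have "norm p > 0" using that by linarith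
    then have "(norm v + 1) * norm p \<le> H x p"
      using b[of p] that by (simp add: R_def field_simps)
    moreover have "- (p \<bullet> v) \<le> norm p * norm v"
      using Cauchy_Schwarz_ineq2[of p v] by linarith
    ultimately show ?thesis using that by (simp add: R_def algebra_simps)
  qed
  have "R \<ge> 1" by (simp add: R_def)
  have "continuous_on (cball 0 R) ?f" by (intro continuous_intros)
  then obtain p where p: "p \<in> cball 0 R" "\<And>q. q \<in> cball 0 R \<Longrightarrow> ?f p \<le> ?f q"
    using continuous_attains_inf[OF compact_cball, of 0 R ?f] \<open>R \<ge> 1\<close> by fastforce
  have min: "?f p \<le> ?f q" for q
  proof (cases "norm q \<le> R")
    case False
    have "?f p \<le> ?f 0" using \<open>R \<ge> 1\<close> by (intro p) auto
    then show ?thesis using big[of q] False by linarith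
  qed (use p in auto)
  have der: "(?f has_derivative (\<lambda>w. (DH x p + v) \<bullet> w)) (at p)"
    by (auto intro!: derivative_eq_intros DH_has_derivative simp: inner_add_right inner_commute)
  have "(\<lambda>w. (DH x p + v) \<bullet> w) = (\<lambda>w. 0)"
    by (rule has_derivative_local_min[OF der]) (use min in auto)
  then have "(DH x p + v) \<bullet> (DH x p + v) = 0" by meson
  then have "DH x p = - v" by (simp add: eq_neg_iff_add_eq_0)
  then show ?thesis ..
qed

text \<open>The inverse of the Legendre transform; continuity in both variables comes from invariance
  of domain, so that no uniform convexity or implicit function theorem is needed.\<close>

definition mom :: "real^'n \<Rightarrow> real^'n \<Rightarrow> real^'n" where
  "mom x v = (THE p. DH x p = - v)"

lemma DH_mom: "DH x (mom x v) = - v"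
  and mom_eq: "DH x p = - v \<Longrightarrow> mom x v = p"
proof -
  have eq: "p = q" if "DH x p = - v" "DH x q = - v" for p q
    by (rule DH_inj[of x]) (simp add: that)
  then have "\<exists>!p. DH x p = - v" using DH_surj[of x v] by blast
  from theI'[OF this] show *: "DH x (mom x v) = - v" by (simp add: mom_def)
  show "DH x p = - v \<Longrightarrow> mom x v = p" by (rule eq[OF *])
qed

lemma mom_continuous: "continuous_on UNIV (\<lambda>z. mom (fst z) (snd z))"
proof -
  \<comment> \<open>Carrying \<open>x\<close> along makes this an injective self-map of R^(2n), so
    equal dimensions hold and the inverse is continuous in both variables at once.\<close>
  let ?\<Psi> = "\<lambda>z::(real^'n) \<times> (real^'n). (fst z, - DH (fst z) (snd z))"
  have inj: "inj_on ?\<Psi> UNIV" using DH_inj by (auto simp: inj_on_def)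
  have surj: "range ?\<Psi> = UNIV"
  proof -
    have "z = ?\<Psi> (fst z, mom (fst z) (snd z))" for z by (simp add: DH_mom)
    then show ?thesis by blast
  qed
  have "continuous_on UNIV ?\<Psi>" by (intro continuous_intros DH_continuous)
  from invariance_of_domain_homeomorphism[OF open_UNIV this _ inj]
  obtain \<Theta> where "homeomorphism UNIV (range ?\<Psi>) ?\<Psi> \<Theta>" by auto
  then have "continuous_on UNIV \<Theta>" and inv: "\<And>z. ?\<Psi> (\<Theta> z) = z"
    unfolding surj homeomorphism_def by auto
  have "snd (\<Theta> z) = mom (fst z) (snd z)" for z
  proof -
    have "fst (\<Theta> z) = fst z" "- DH (fst (\<Theta> z)) (snd (\<Theta> z)) = snd z"
      using arg_cong[OF inv[of z], of fst] arg_cong[OF inv[of z], of snd] by simp_all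
    then have "DH (fst z) (snd (\<Theta> z)) = - snd z" by (metis minus_minus)
    then show ?thesis by (rule mom_eq[symmetric])
  qed
  then have "(\<lambda>z. mom (fst z) (snd z)) = (\<lambda>z. snd (\<Theta> z))" by auto
  then show ?thesis by (simp only: continuous_on_snd[OF \<open>continuous_on UNIV \<Theta>\<close>])
qed

lemma Lagr_ge: "- (p \<bullet> v) - H x p \<le> - (mom x v \<bullet> v) - H x (mom x v)"
  using DH_tangent[of x "mom x v" p] by (simp add: DH_mom inner_diff_right inner_commute)

lemma Lagr_eq: "Lagr H x v = - (mom x v \<bullet> v) - H x (mom x v)"
  unfolding Lagr_def
  by (rule cSup_eq_maximum) (use Lagr_ge in auto)

lemma Fenchel: "- (p \<bullet> v) \<le> Lagr H x v + H x p"
  using Lagr_ge[of p v x] by (simp add: Lagr_eq)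

text \<open>The strict tangent inequality makes the maximizing momentum unique; this uniqueness
  later identifies the limit of the momenta of approximate subsolutions.\<close>

lemma Fenchel_eq_iff: "Lagr H x v + H x p = - (p \<bullet> v) \<longleftrightarrow> p = mom x v"
  using DH_tangent_strict[of p "mom x v" x]
  by (cases "p = mom x v") (auto simp: Lagr_eq DH_mom inner_diff_right inner_commute)

lemma Fenchel_DH: "Lagr H x (- DH x p) + H x p = p \<bullet> DH x p"
proof -
  have "mom x (- DH x p) = p" by (rule mom_eq) simp
  then show ?thesis by (simp add: Lagr_eq)
qed

lemma Lagr_continuous: "continuous_on UNIV (\<lambda>z. Lagr H (fst z) (snd z))"
  unfolding Lagr_eq by (intro continuous_intros mom_continuous)

lemma Lagr_continuous_compose [continuous_intros]:
  "continuous_on S f \<Longrightarrow> continuous_on S g \<Longrightarrow> continuous_on S (\<lambda>s. Lagr H (f s) (g s))"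
  using continuous_on_compose2[OF Lagr_continuous, of S "\<lambda>s. (f s, g s)"]
  by (auto intro!: continuous_intros)

lemma Lagr_periodic: "zn_periodic (\<lambda>x. Lagr H x v)"
  unfolding zn_periodic_def Lagr_def using periodic by (simp add: zn_periodic_def)

text \<open>Fenchel's inequality at \<open>v\<close> and at \<open>w\<close> traps the linearization
  error between 0 and the pairing of \<open>mom x w - mom x v\<close> with \<open>v - w\<close>, so
  continuity of \<open>mom\<close> is all that differentiability requires.\<close>

lemma Lagr_has_derivative: "(Lagr H x has_derivative (\<lambda>w. (- mom x v) \<bullet> w)) (at v)"
proof (rule has_derivativeI)
  show "bounded_linear (\<lambda>w. (- mom x v) \<bullet> w)" by (rule bounded_linear_inner_right)
  have lower: "Lagr H x v - mom x v \<bullet> (w - v) \<le> Lagr H x w" for v w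
    using Fenchel[of "mom x v" w x] by (simp add: Lagr_eq inner_diff_right)
  have "continuous_on UNIV (\<lambda>w. mom x w)"
    using continuous_on_compose2[OF mom_continuous
        continuous_on_Pair[OF continuous_on_const[of _ x] continuous_on_id]] by simp
  then have "((\<lambda>w. mom x w) \<longlongrightarrow> mom x v) (at v)"
    by (simp add: continuous_on_def)
  then have lim: "((\<lambda>w. norm (mom x w - mom x v)) \<longlongrightarrow> 0) (at v)"
    using LIM_zero tendsto_norm_zero by blast
  show "((\<lambda>w. (Lagr H x w - Lagr H x v - - mom x v \<bullet> (w - v)) /\<^sub>R norm (w - v)) \<longlongrightarrow> 0) (at v)"
  proof (rule tendsto_rabs_zero_cancel[OF tendsto_sandwich[OF _ _ tendsto_const lim]])
    show "\<forall>\<^sub>F w in at v. 0 \<le> \<bar>(Lagr H x w - Lagr H x v - - mom x v \<bullet> (w - v)) /\<^sub>R norm (w - v)\<bar>"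
      by simp
    have "\<bar>(Lagr H x w - Lagr H x v - - mom x v \<bullet> (w - v)) /\<^sub>R norm (w - v)\<bar> \<le> norm (mom x w - mom x v)"
      if "w \<noteq> v" for w
    proof -
      have "\<bar>(mom x w - mom x v) \<bullet> (w - v)\<bar> \<le> norm (mom x w - mom x v) * norm (w - v)"
        by (rule Cauchy_Schwarz_ineq2)
      then have "\<bar>Lagr H x w - Lagr H x v - - mom x v \<bullet> (w - v)\<bar> \<le> norm (mom x w - mom x v) * norm (w - v)"
        using lower[of v w] lower[of w v] by (simp add: inner_diff_left inner_diff_right)
      then show ?thesis using that by (simp add: abs_mult divide_simps)
    qed
    then show "\<forall>\<^sub>F w in at v. \<bar>(Lagr H x w - Lagr H x v - - mom x v \<bullet> (w - v)) /\<^sub>R norm (w - v)\<bar> \<le> norm (mom x w - mom x v)"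
      by (auto simp: eventually_at_filter)
  qed
qed

lemma Phi_eq: "Phi H = (\<lambda>z. (fst z, mom (fst z) (snd z)))"
  unfolding Phi_def using grad_eq[OF Lagr_has_derivative] by auto

lemma Phi_measurable [measurable]: "Phi H \<in> borel_measurable borel"
  unfolding Phi_eq
  by (intro borel_measurable_continuous_onI continuous_intros mom_continuous)

text \<open>Superlinearity is assumed separately for each \<open>x\<close>; uniformity comes from
  Fenchel's inequality with the velocity \<open>- sgn p\<close>, since the Lagrangian is bounded
  over the torus times the unit ball.\<close>

lemma coercive:
  obtains M where "\<And>x p. norm p \<le> H x p + M"
proof -
  obtain M where M: "\<And>x v. norm v \<le> 1 \<Longrightarrow> \<bar>Lagr H x v\<bar> \<le> M"
    using periodic_bounded[OF Lagr_continuous Lagr_periodic, of 1] by metis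
  have "norm p \<le> H x p + M" for x p
  proof -
    have "- (p \<bullet> (- sgn p)) \<le> Lagr H x (- sgn p) + H x p" by (rule Fenchel)
    moreover have "p \<bullet> sgn p = norm p"
      by (simp add: sgn_div_norm dot_square_norm power2_eq_square field_simps)
    moreover have "Lagr H x (- sgn p) \<le> M"
      using M[of "- sgn p" x] by (cases "p = 0") (auto simp: norm_sgn)
    ultimately show ?thesis by simp
  qed
  then show ?thesis using that by blast
qed

lemma DH_periodic: "zn_periodic (\<lambda>x. DH x p)"
proof -
  have "H (x + k) = H x" if "int_vec k" for x k
    using periodic that by (auto simp: zn_periodic_def)
  then show ?thesis unfolding zn_periodic_def grad_H[symmetric] by simp
qed

lemma DH_bounded:
  obtains C where "\<And>x p. norm p \<le> R \<Longrightarrow> norm (DH x p) \<le> C"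
proof -
  have "continuous_on UNIV (\<lambda>z. norm (DH (fst z) (snd z)))"
    by (intro continuous_intros DH_continuous)
  moreover have "zn_periodic (\<lambda>x. norm (DH x p))" for p
    using DH_periodic[of p] by (simp add: zn_periodic_def)
  ultimately obtain C where "\<And>x p. norm p \<le> R \<Longrightarrow> \<bar>norm (DH x p)\<bar> \<le> C"
    using periodic_bounded[of "\<lambda>x p. norm (DH x p)" R] by blast
  then have "\<And>x p. norm p \<le> R \<Longrightarrow> norm (DH x p) \<le> C" by simp
  then show ?thesis by (rule that)
qed

end

subsection \<open>Polygonal curves and the critical value\<close>

locale cell_problem = hamiltonian H for H :: "real^'n \<Rightarrow> real^'n \<Rightarrow> real" +
  fixes P :: "real^'n"
begin

text \<open>The Lagrangian of the shifted Hamiltonian \<open>H x (P + q)\<close> in the variable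
  \<open>q\<close>.\<close>

definition LP :: "real^'n \<Rightarrow> real^'n \<Rightarrow> real" where
  "LP x v = Lagr H x v + P \<bullet> v"

lemma LP_continuous: "continuous_on UNIV (\<lambda>z. LP (fst z) (snd z))"
  unfolding LP_def by (intro continuous_intros)

lemma LP_periodic: "zn_periodic (\<lambda>x. LP x v)"
  using Lagr_periodic by (simp add: LP_def zn_periodic_def)

lemma LP_Fenchel: "- (q \<bullet> v) \<le> LP x v + H x (P + q)"
  using Fenchel[of "P + q" v x] by (simp add: LP_def inner_add_left)

lemma LP_bounded_below:
  obtains M where "\<And>x v. - M \<le> LP x v"
proof -
  obtain M where "\<And>x p. norm p \<le> norm P \<Longrightarrow> \<bar>H x p\<bar> \<le> M"
    using periodic_bounded[OF H_continuous periodic] by metis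
  then have "- M \<le> LP x v" for x v
    using LP_Fenchel[of 0 v x] by (smt (verit) add.right_neutral inner_zero_left)
  then show ?thesis using that by blast
qed

text \<open>\<open>reach x y T A\<close>: some polygonal curve from \<open>x\<close> to \<open>y\<close> of duration \<open>T\<close> has action at most \<open>A\<close>.
  Bounding the action on each segment by a constant times its duration avoids integrals.\<close>

inductive reach :: "real^'n \<Rightarrow> real^'n \<Rightarrow> real \<Rightarrow> real \<Rightarrow> bool" where
  stay: "reach x x 0 0"
| step: "0 \<le> t \<Longrightarrow> (\<And>s. 0 \<le> s \<Longrightarrow> s \<le> t \<Longrightarrow> LP (x + s *\<^sub>R v) v \<le> K) \<Longrightarrow>
    reach (x + t *\<^sub>R v) y T A \<Longrightarrow> reach x y (t + T) (t * K + A)"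

lemma reach_segment:
  assumes "0 \<le> t" "\<And>s. 0 \<le> s \<Longrightarrow> s \<le> t \<Longrightarrow> LP (x + s *\<^sub>R v) v \<le> K"
  shows "reach x (x + t *\<^sub>R v) t (t * K)"
  using reach.step[OF assms reach.stay] by simp

lemma reach_nonneg: "reach x y T A \<Longrightarrow> 0 \<le> T"
  by (induction rule: reach.induct) auto

lemma reach_lower:
  assumes "\<And>x v. - M \<le> LP x v"
  shows "reach x y T A \<Longrightarrow> - M * T \<le> A"
proof (induction rule: reach.induct)
  case (step t x v K y T A)
  have "- M \<le> K" using assms[of x v] step(1) step(2)[of 0] by simp
  then have "t * (- M) \<le> t * K" using step(1) by (intro mult_left_mono) auto
  then show ?case using step by (simp add: algebra_simps)
qed simp

lemma reach_trans: "reach x y T A \<Longrightarrow> reach y z S B \<Longrightarrow> reach x z (T + S) (A + B)"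
proof (induction rule: reach.induct)
  case (step t x v K y T A)
  from reach.step[OF step(1,2) step.IH[OF step.prems]] show ?case
    by (simp add: add.assoc)
qed simp

lemma reach_translate:
  assumes "int_vec k"
  shows "reach x y T A \<Longrightarrow> reach (x + k) (y + k) T A"
proof (induction rule: reach.induct)
  case (step t x v K y T A)
  have "LP (x + k + s *\<^sub>R v) v \<le> K" if "0 \<le> s" "s \<le> t" for s
    using step(2)[OF that] zn_periodicD[OF LP_periodic assms, of "x + s *\<^sub>R v" v]
    by (simp add: algebra_simps)
  moreover have "reach (x + k + t *\<^sub>R v) (y + k) T A"
    using step.IH by (simp add: algebra_simps)
  ultimately show ?case by (intro reach.step step(1))
qed (rule reach.stay)

text \<open>The bound \<open>K\<close> of a segment is inherited by its parts, so a cut inside a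
  segment divides its cost \<open>t * K\<close> in proportion to time, with no loss.\<close>

lemma reach_split:
  assumes "reach x y T A" "0 \<le> S" "S \<le> T"
  obtains z A1 A2 where "reach x z S A1" "reach z y (T - S) A2" "A = A1 + A2"
proof -
  have "\<exists>z A1 A2. reach x z S A1 \<and> reach z y (T - S) A2 \<and> A = A1 + A2"
    using assms
  proof (induction arbitrary: S rule: reach.induct)
    case (stay x)
    then show ?case using reach.stay[of x] by (intro exI[of _ x] exI[of _ 0]) auto
  next
    case (step t x v K y T A)
    show ?case
    proof (cases "S \<le> t")
      case True
      have "reach x (x + S *\<^sub>R v) S (S * K)"
        using step True by (intro reach_segment) auto
      moreover have "LP (x + S *\<^sub>R v + s *\<^sub>R v) v \<le> K" if "0 \<le> s" "s \<le> t - S" for s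
        using step(2)[of "S + s"] that step.prems by (simp add: algebra_simps)
      then have "reach (x + S *\<^sub>R v) y ((t - S) + T) ((t - S) * K + A)"
        using True step(3) by (intro reach.step) (auto simp: algebra_simps)
      ultimately show ?thesis
        by (intro exI[of _ "x + S *\<^sub>R v"] exI[of _ "S * K"] exI[of _ "(t - S) * K + A"])
          (auto simp: algebra_simps)
    next
      case False
      then obtain z A1 A2 where z: "reach (x + t *\<^sub>R v) z (S - t) A1" "reach z y (T - (S - t)) A2" "A = A1 + A2"
        using step.IH[of "S - t"] step.prems by auto
      have "reach x z (t + (S - t)) (t * K + A1)"
        by (rule reach.step[OF step(1,2) z(1)])
      then show ?thesis using z
        by (intro exI[of _ z] exI[of _ "t * K + A1"] exI[of _ A2]) (auto simp: algebra_simps)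
    qed
  qed
  then show ?thesis using that by blast
qed

text \<open>Some integer translate of the target lies in the unit box based at \<open>x\<close>, so
  one straight segment traversed in unit time has velocity bounded independently of \<open>x\<close>
  and \<open>y\<close>.\<close>

lemma reach_connect:
  obtains C where "\<And>x y. \<exists>k. int_vec k \<and> reach x (y + k) 1 C"
proof -
  have "bounded (cbox 0 (1::real^'n))" by simp
  then obtain R where R: "\<And>w. w \<in> cbox 0 (1::real^'n) \<Longrightarrow> norm w \<le> R"
    unfolding bounded_iff by blast
  obtain C where C: "\<And>x v. norm v \<le> R \<Longrightarrow> \<bar>LP x v\<bar> \<le> C"
    using periodic_bounded[OF LP_continuous LP_periodic] by metis
  have "\<exists>k. int_vec k \<and> reach x (y + k) 1 C" for x y
  proof -
    define w where "w = torus_rep (y - x)"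
    have "norm w \<le> R" using R torus_rep_in fund_dom_cbox unfolding w_def by blast
    then have "LP (x + s *\<^sub>R w) w \<le> C" for s
      using C[of w "x + s *\<^sub>R w"] by linarith
    then have "reach x (x + 1 *\<^sub>R w) 1 (1 * C)" by (intro reach_segment) auto
    moreover have "x + w = y + (w - (y - x))" by simp
    ultimately show ?thesis using int_vec_torus_rep[of "y - x"] by (metis scaleR_one mult_1 w_def)
  qed
  then show ?thesis using that by blast
qed

lemma loop_iterate:
  assumes "int_vec k" "reach x (x + k) T A"
  shows "reach x (x + of_nat m *\<^sub>R k) (of_nat m * T) (of_nat m * A)"
proof (induction m)
  case (Suc m)
  have "reach (x + of_nat m *\<^sub>R k) (x + k + of_nat m *\<^sub>R k) T A"
    by (rule reach_translate[OF int_vec_scale[OF assms(1)] assms(2)])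
  from reach_trans[OF Suc this] show ?case by (simp add: algebra_simps)
qed (auto intro: reach.stay)

section \<open>The critical value as a threshold for closed curves\<close>

definition supercritical :: "real set" where
  "supercritical = {a. \<forall>x k T A. int_vec k \<longrightarrow> reach x (x + k) T A \<longrightarrow> 0 \<le> A + a * T}"

text \<open>Mane's critical value of \<open>LP\<close>, with closed curves of every integer
  displacement allowed.\<close>

definition crit :: real where
  "crit = Inf supercritical"

lemma supercriticalD: "a \<in> supercritical \<Longrightarrow> int_vec k \<Longrightarrow> reach x (x + k) T A \<Longrightarrow> 0 \<le> A + a * T"
  unfolding supercritical_def by blast

lemma supercritical_nonempty: "supercritical \<noteq> {}"
proof -
  obtain M where "\<And>x v. - M \<le> LP x v" using LP_bounded_below by blast
  from reach_lower[OF this] have "0 \<le> A + M * T" if "reach x y T A" for x y T A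
    using that by fastforce
  then have "M \<in> supercritical" unfolding supercritical_def by blast
  then show ?thesis by blast
qed

lemma supercritical_bdd: "bdd_below supercritical"
proof (rule bdd_belowI)
  fix a assume "a \<in> supercritical"
  moreover have "reach 0 (0 + 1 *\<^sub>R 0) 1 (1 * LP 0 0)" by (rule reach_segment) auto
  ultimately show "- LP 0 0 \<le> a" using supercriticalD[of a 0 0 1 "LP 0 0"] by simp
qed

lemma crit_le: "a \<in> supercritical \<Longrightarrow> crit \<le> a"
  unfolding crit_def using supercritical_bdd by (rule cInf_lower[rotated])

lemma crit_supercritical: "crit \<in> supercritical"
  unfolding supercritical_def
proof (intro CollectI allI impI)
  fix x k T A assume *: "int_vec k" "reach x (x + k) T A"
  show "0 \<le> A + crit * T"
  proof (cases "T = 0")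
    \<comment> \<open>At duration zero the level drops out of the condition, so any supercritical
      level decides this case; the other case divides by \<open>T\<close>.\<close>
    case True
    then show ?thesis using supercritical_nonempty supercriticalD[OF _ *] by auto
  next
    case False
    then have T: "T > 0" using reach_nonneg[OF *(2)] by simp
    have "- A / T \<le> Inf supercritical"
      using supercritical_nonempty
    proof (rule cInf_greatest)
      fix a assume "a \<in> supercritical"
      from supercriticalD[OF this *] show "- A / T \<le> a" using T by (simp add: field_simps)
    qed
    then show ?thesis using T by (simp add: crit_def field_simps)
  qed
qed

lemma subcritical_loop:
  assumes "a < crit"
  obtains x k T A where "int_vec k" "reach x (x + k) T A" "0 < T" "A + a * T < 0"
proof -
  have "a \<notin> supercritical" using assms crit_le by force
  then obtain x k T A where *: "int_vec k" "reach x (x + k) T A" "A + a * T < 0"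
    unfolding supercritical_def by force
  moreover have "T \<noteq> 0" using supercriticalD[OF crit_supercritical *(1,2)] *(3) by auto
  ultimately show ?thesis using that reach_nonneg[OF *(2)] by simp
qed

text \<open>Any curve can be closed up by a connecting segment of bounded cost, and closed curves
  have nonnegative excess at level \<open>crit\<close>.\<close>

lemma reach_crit_lower:
  obtains C where "\<And>x y T A. reach x y T A \<Longrightarrow> - C \<le> A + crit * T"
proof -
  obtain C where C: "\<And>x y. \<exists>k. int_vec k \<and> reach x (y + k) 1 C" using reach_connect by blast
  have "- (C + crit) \<le> A + crit * T" if "reach x y T A" for x y T A
  proof -
    obtain k where k: "int_vec k" "reach y (x + k) 1 C" using C by blast
    from supercriticalD[OF crit_supercritical k(1) reach_trans[OF that k(2)]]
    show ?thesis by (simp add: algebra_simps)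
  qed
  then show ?thesis using that by blast
qed

text \<open>Otherwise every curve of duration \<open>S\<close> has excess above \<open>1\<close>; cutting iterated loops into such
  pieces, \<open>crit - 1 / S\<close> would be supercritical.\<close>

lemma reach_crit_upper: "\<exists>x y T A. reach x y T A \<and> S \<le> T \<and> A + crit * T \<le> 1"
proof (rule ccontr)
  assume neg: "\<not> ?thesis"
  define S' where "S' = max S 1"
  have S': "S' > 0" "S \<le> S'" by (auto simp: S'_def)
  have big: "1 < A + crit * T" if "reach x y T A" "S' \<le> T" for x y T A
    using neg that order_trans[OF S'(2)] by (meson not_le)
  \<comment> \<open>The last of the \<open>n\<close> pieces keeps all surplus duration, so every
    piece lasts at least \<open>S'\<close> and has excess above 1.\<close>
  have many: "real n \<le> A + crit * T" if "reach x y T A" "real n * S' \<le> T" "1 \<le> n" for n x y T A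
    using that
  proof (induction n arbitrary: x T A)
    case (Suc n)
    show ?case
    proof (cases "n = 0")
      case True
      then show ?thesis using big[OF Suc.prems(1)] Suc.prems(2) by simp
    next
      case False
      have "0 \<le> real n * S'" using S' by simp
      then have "S' \<le> T" using Suc.prems(2) by (simp add: algebra_simps)
      then obtain z A1 A2 where z: "reach x z S' A1" "reach z y (T - S') A2" "A = A1 + A2"
        using reach_split[OF Suc.prems(1), of S'] S' by (metis less_imp_le)
      have "real n \<le> A2 + crit * (T - S')"
        using Suc.IH[OF z(2)] Suc.prems(2) False by (simp add: algebra_simps)
      moreover have "1 < A1 + crit * S'" using big[OF z(1)] by simp
      ultimately show ?thesis using z(3) by (simp add: algebra_simps)
    qed
  qed simp
  have "crit - 1 / S' \<in> supercritical"
    unfolding supercritical_def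
  proof (intro CollectI allI impI)
    fix x k T A assume *: "int_vec k" "reach x (x + k) T A"
    show "0 \<le> A + (crit - 1 / S') * T"
    proof (rule ccontr)
      define b where "b = A + (crit - 1 / S') * T"
      assume "\<not> ?thesis"
      then have b: "b < 0" by (simp add: b_def)
      have "0 \<le> A + crit * T" by (rule supercriticalD[OF crit_supercritical *])
      then have "0 < T" using b S' reach_nonneg[OF *(2)] by (cases "T = 0") (auto simp: b_def)
      \<comment> \<open>The first summand makes the \<open>m\<close>-fold loop long enough to hold a
        piece of duration \<open>S'\<close>; the second makes \<open>m\<close> times the deficit
        \<open>- b\<close> exceed 1, which is more than rounding to whole pieces can absorb.\<close>
      obtain m :: nat where m: "2 * S' / T + 1 / (- b) < real m"
        using reals_Archimedean2 by blast
      have "0 < 2 * S' / T" "0 < 1 / (- b)" using S' b \<open>0 < T\<close> by auto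
      then have m1: "2 * S' / T < real m" and m2: "1 / (- b) < real m" using m by linarith+
      define n where "n = nat \<lfloor>real m * T / S'\<rfloor>"
      have "2 < real m * T / S'" using m1 S' \<open>0 < T\<close> by (simp add: field_simps)
      then have n: "1 \<le> n" "real n \<le> real m * T / S'" "real m * T / S' - 1 < real n"
        unfolding n_def by linarith+
      have "real n \<le> real m * A + crit * (real m * T)"
        by (rule many[OF loop_iterate[OF *] _ n(1)]) (use n(2) S' in \<open>simp add: field_simps\<close>)
      then have "- 1 < real m * A + crit * (real m * T) - real m * T / S'" using n(3) by linarith
      also have "\<dots> = real m * b" by (simp add: b_def algebra_simps)
      finally have "real m * (- b) < 1" by simp
      then show False using m2 b by (simp add: field_simps)
    qed
  qed
  from crit_le[OF this] show False using S' by simp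
qed

subsection \<open>The weak KAM solution\<close>

text \<open>Fathi's domination of \<open>w\<close> by \<open>LP + crit\<close>, tested on straight
  segments only. The value at the starting point stands on the left because the Lagrangian pairs
  with \<open>- p\<close>. The condition is linear in \<open>w\<close> up to constants, so it
  survives suprema and averaging.\<close>

definition dominated :: "(real^'n \<Rightarrow> real) \<Rightarrow> bool" where
  "dominated w \<longleftrightarrow> (\<forall>x v t K. 0 \<le> t \<longrightarrow> (\<forall>s. 0 \<le> s \<longrightarrow> s \<le> t \<longrightarrow> LP (x + s *\<^sub>R v) v \<le> K) \<longrightarrow>
     w x \<le> t * (K + crit) + w (x + t *\<^sub>R v))"

lemma dominatedD:
  "dominated w \<Longrightarrow> 0 \<le> t \<Longrightarrow> (\<And>s. 0 \<le> s \<Longrightarrow> s \<le> t \<Longrightarrow> LP (x + s *\<^sub>R v) v \<le> K) \<Longrightarrow>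
    w x \<le> t * (K + crit) + w (x + t *\<^sub>R v)"
  unfolding dominated_def by blast

text \<open>Joining two points at unit speed costs at most a constant times their distance. The
  constant is common to all dominated functions, which the uniform convergence of the value
  functions needs.\<close>

lemma dominated_lipschitz:
  obtains \<Lambda> where "0 < \<Lambda>" "\<And>w x y. dominated w \<Longrightarrow> \<bar>w x - w y\<bar> \<le> \<Lambda> * dist x y"
proof -
  obtain C where C: "\<And>x v. norm v \<le> 1 \<Longrightarrow> \<bar>LP x v\<bar> \<le> C"
    using periodic_bounded[OF LP_continuous LP_periodic, of 1] by metis
  define \<Lambda> where "\<Lambda> = \<bar>C + crit\<bar> + 1"
  have *: "w x - w y \<le> \<Lambda> * dist x y" if w: "dominated w" for w x y
  proof -
    have "LP (x + s *\<^sub>R sgn (y - x)) (sgn (y - x)) \<le> C" for s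
      using C[of "sgn (y - x)" "x + s *\<^sub>R sgn (y - x)"] by (cases "y = x") (auto simp: norm_sgn)
    then have "w x \<le> dist x y * (C + crit) + w (x + dist x y *\<^sub>R sgn (y - x))"
      by (intro dominatedD[OF w]) auto
    moreover have "dist x y *\<^sub>R sgn (y - x) = y - x"
      by (cases "x = y") (simp_all add: dist_norm sgn_div_norm norm_minus_commute)
    moreover have "dist x y * (C + crit) \<le> dist x y * \<Lambda>"
      by (intro mult_left_mono) (auto simp: \<Lambda>_def)
    ultimately show ?thesis by (simp add: mult.commute)
  qed
  have "\<bar>w x - w y\<bar> \<le> \<Lambda> * dist x y" if "dominated w" for w x y
    using *[OF that, of x y] *[OF that, of y x] by (simp add: dist_commute)
  then show ?thesis using that[of \<Lambda>] by (auto simp: \<Lambda>_def)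
qed

lemma dominated_continuous:
  assumes "dominated w"
  shows "continuous_on UNIV w"
proof -
  obtain \<Lambda> where "0 < \<Lambda>" "\<And>x y. \<bar>w x - w y\<bar> \<le> \<Lambda> * dist x y"
    using dominated_lipschitz assms by metis
  then have "\<Lambda>-lipschitz_on UNIV w"
    by (intro lipschitz_onI) (auto simp: dist_real_def)
  then show ?thesis by (rule lipschitz_on_continuous_on)
qed

text \<open>Domination is tested in the direction \<open>- DH x0 p\<close>, where Fenchel's
  inequality for the momentum \<open>p\<close> of the test function is an equality.\<close>

lemma dominated_visc_sub:
  assumes "dominated w"
  shows "visc_sub H P crit w"
  unfolding visc_sub_def
proof (intro allI impI, elim conjE exE)
  fix \<phi> x0 e
  assume \<phi>: "C1_fun \<phi>" and e: "0 < e" "\<forall>y. dist y x0 < e \<longrightarrow> w y - \<phi> y \<le> w x0 - \<phi> x0"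
  define p where "p = P + grad \<phi> x0"
  define v where "v = - DH x0 p"
  have "- (LP x0 v + crit) \<le> grad \<phi> x0 \<bullet> v"
  proof (rule field_le_epsilon)
    fix \<epsilon> :: real assume "0 < \<epsilon>"
    have cont: "continuous_on UNIV (\<lambda>s. LP (x0 + s *\<^sub>R v) v)"
      unfolding LP_def by (intro continuous_intros)
    then have "((\<lambda>s. LP (x0 + s *\<^sub>R v) v) \<longlongrightarrow> LP (x0 + 0 *\<^sub>R v) v) (at 0)"
      unfolding continuous_on_def by blast
    then have "\<forall>\<^sub>F s in at 0. LP (x0 + s *\<^sub>R v) v < LP x0 v + \<epsilon>"
      by (rule order_tendstoD) (use \<open>0 < \<epsilon>\<close> in simp)
    then obtain d where d: "0 < d" "\<And>s. s \<noteq> 0 \<Longrightarrow> dist s 0 < d \<Longrightarrow> LP (x0 + s *\<^sub>R v) v < LP x0 v + \<epsilon>"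
      unfolding eventually_at by auto
    have dd: "LP (x0 + s *\<^sub>R v) v \<le> LP x0 v + \<epsilon>" if "0 \<le> s" "s < d" for s
      using d(2)[of s] that \<open>0 < \<epsilon>\<close> by (cases "s = 0") auto
    \<comment> \<open>Short enough for both the bound on \<open>LP\<close> along the segment and the
      touching inequality at its endpoint; the added 1 avoids dividing by zero when
      \<open>v = 0\<close>.\<close>
    define d' where "d' = min d (e / (norm v + 1))"
    have d': "0 < d'" using d e by (auto simp: d'_def add_nonneg_pos)
    have "- (grad \<phi> x0 \<bullet> v) \<le> LP x0 v + \<epsilon> + crit"
    proof (rule C1_fun_slope_le[OF \<phi> d'])
      fix t assume t: "0 < t" "t < d'"
      have "0 < norm v + 1" by (simp add: add_nonneg_pos)
      moreover have "t < e / (norm v + 1)" using t by (simp add: d'_def)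
      ultimately have "t * (norm v + 1) < e" by (simp only: pos_less_divide_eq)
      moreover have "t * norm v \<le> t * (norm v + 1)" using t by (intro mult_left_mono) auto
      ultimately have "t * norm v < e" by linarith
      then have "dist (x0 + t *\<^sub>R v) x0 < e" using t by (simp add: dist_norm)
      then have "w (x0 + t *\<^sub>R v) - \<phi> (x0 + t *\<^sub>R v) \<le> w x0 - \<phi> x0" using e by blast
      moreover have "w x0 \<le> t * (LP x0 v + \<epsilon> + crit) + w (x0 + t *\<^sub>R v)"
        by (rule dominatedD[OF assms]) (use t dd d'_def in auto)
      ultimately show "\<phi> x0 \<le> t * (LP x0 v + \<epsilon> + crit) + \<phi> (x0 + t *\<^sub>R v)" by linarith
    qed
    then show "- (LP x0 v + crit) \<le> grad \<phi> x0 \<bullet> v + \<epsilon>" by simp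
  qed
  moreover have "Lagr H x0 v + H x0 p = - (p \<bullet> v)"
    using Fenchel_DH[of x0 p] by (simp add: v_def)
  ultimately show "H x0 (P + grad \<phi> x0) \<le> crit"
    by (simp add: LP_def p_def inner_add_left)
qed

lemma C1_subsolution_segment:
  assumes "C1_fun \<phi>" "0 \<le> t"
    and "\<And>s. 0 \<le> s \<Longrightarrow> s \<le> t \<Longrightarrow> LP (x + s *\<^sub>R v) v \<le> K"
    and "\<And>s. 0 \<le> s \<Longrightarrow> s \<le> t \<Longrightarrow> H (x + s *\<^sub>R v) (P + grad \<phi> (x + s *\<^sub>R v)) \<le> b"
  shows "\<phi> x \<le> t * (K + b) + \<phi> (x + t *\<^sub>R v)"
proof -
  let ?f = "\<lambda>s. \<phi> (x + s *\<^sub>R v) + s * (K + b)"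
  have "?f 0 \<le> ?f t"
  proof (rule DERIV_nonneg_imp_nondecreasing[OF assms(2)])
    fix s assume s: "0 \<le> s" "s \<le> t"
    have "(?f has_real_derivative (grad \<phi> (x + s *\<^sub>R v) \<bullet> v + (K + b))) (at s)"
      by (auto intro!: derivative_eq_intros C1_fun_segment[OF assms(1)])
    moreover have "0 \<le> grad \<phi> (x + s *\<^sub>R v) \<bullet> v + (K + b)"
      using LP_Fenchel[of "grad \<phi> (x + s *\<^sub>R v)" v "x + s *\<^sub>R v"] assms(3)[OF s] assms(4)[OF s] by linarith
    ultimately show "\<exists>y. (?f has_real_derivative y) (at s) \<and> 0 \<le> y" by blast
  qed
  then show ?thesis by simp
qed

section \<open>Value functions for curves of long duration and their limit\<close>

text \<open>Durations of at least \<open>S\<close>, rather than exactly \<open>S\<close>, make the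
  infimum monotone in \<open>S\<close>, so its limit is a supremum. They also give domination at
  once, because prepending a segment keeps a curve admissible.\<close>

definition value_fun :: "real \<Rightarrow> real^'n \<Rightarrow> real" where
  "value_fun S x = Inf {A + crit * T | y T A. reach x y T A \<and> S \<le> T}"

lemma value_fun_bdd: "bdd_below {A + crit * T | y T A. reach x y T A \<and> S \<le> T}"
proof -
  obtain C where "\<And>x y T A. reach x y T A \<Longrightarrow> - C \<le> A + crit * T" using reach_crit_lower by blast
  then show ?thesis by (intro bdd_belowI[of _ "- C"]) auto
qed

lemma value_fun_le: "reach x y T A \<Longrightarrow> S \<le> T \<Longrightarrow> value_fun S x \<le> A + crit * T"
  unfolding value_fun_def by (rule cInf_lower[OF _ value_fun_bdd]) auto

text \<open>The endpoint is free, so from every \<open>x\<close> a unit-time segment can first join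
  a translate of one cheap long curve.\<close>

lemma value_fun_upper:
  obtains B where "\<And>S x. \<exists>y T A. reach x y T A \<and> S \<le> T \<and> A + crit * T \<le> B"
proof -
  obtain C where C: "\<And>x y. \<exists>k. int_vec k \<and> reach x (y + k) 1 C" using reach_connect by blast
  have "\<exists>y T A. reach x y T A \<and> S \<le> T \<and> A + crit * T \<le> C + crit + 1" for S x
  proof -
    obtain z y T A where z: "reach z y T A" "S \<le> T" "A + crit * T \<le> 1" using reach_crit_upper by blast
    obtain k where k: "int_vec k" "reach x (z + k) 1 C" using C by blast
    have "reach x (y + k) (1 + T) (C + A)" by (rule reach_trans[OF k(2) reach_translate[OF k(1) z(1)]])
    moreover have "S \<le> 1 + T" "C + A + crit * (1 + T) \<le> C + crit + 1" using z by (auto simp: algebra_simps)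
    ultimately show ?thesis by blast
  qed
  then show ?thesis using that by blast
qed

lemma value_fun_greatest:
  assumes "\<And>y T A. reach x y T A \<Longrightarrow> S \<le> T \<Longrightarrow> b \<le> A + crit * T"
  shows "b \<le> value_fun S x"
  unfolding value_fun_def
proof (rule cInf_greatest)
  obtain B where "\<And>S x. \<exists>y T A. reach x y T A \<and> S \<le> T \<and> A + crit * T \<le> B"
    using value_fun_upper by blast
  then show "{A + crit * T | y T A. reach x y T A \<and> S \<le> T} \<noteq> {}" by blast
qed (use assms in auto)

lemma value_fun_bounded:
  obtains B where "\<And>S x. value_fun S x \<le> B"
proof -
  obtain B where B: "\<And>S x. \<exists>y T A. reach x y T A \<and> S \<le> T \<and> A + crit * T \<le> B"
    using value_fun_upper by blast
  have "value_fun S x \<le> B" for S x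
    using B[of x S] value_fun_le[of x _ _ _ S] by (blast intro: order_trans)
  then show ?thesis using that by blast
qed

lemma value_fun_mono: "S \<le> S' \<Longrightarrow> value_fun S x \<le> value_fun S' x"
  by (rule value_fun_greatest) (auto intro: value_fun_le)

lemma value_fun_dominated: "dominated (value_fun S)"
  unfolding dominated_def
proof (intro allI impI)
  fix x v t K
  assume t: "0 \<le> t" and K: "\<forall>s. 0 \<le> s \<longrightarrow> s \<le> t \<longrightarrow> LP (x + s *\<^sub>R v) v \<le> K"
  have "value_fun S x - t * (K + crit) \<le> value_fun S (x + t *\<^sub>R v)"
  proof (rule value_fun_greatest)
    fix y T A assume r: "reach (x + t *\<^sub>R v) y T A" "S \<le> T"
    have "reach x y (t + T) (t * K + A)" using K by (intro reach.step[OF t _ r(1)]) auto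
    from value_fun_le[OF this, of S] show "value_fun S x - t * (K + crit) \<le> A + crit * T"
      using t r(2) by (simp add: algebra_simps)
  qed
  then show "value_fun S x \<le> t * (K + crit) + value_fun S (x + t *\<^sub>R v)" by simp
qed

lemma value_fun_periodic: "zn_periodic (value_fun S)"
  unfolding zn_periodic_def
proof (intro allI impI antisym value_fun_greatest)
  fix x k :: "real^'n" and y T A
  assume k: "int_vec k"
  { assume "reach x y T A" "S \<le> T"
    then show "value_fun S (x + k) \<le> A + crit * T"
      by (intro value_fun_le[OF reach_translate[OF k]]) }
  { assume "reach (x + k) y T A" "S \<le> T"
    then have "reach x (y - k) T A" using reach_translate[of "- k" "x + k" y T A] k by simp
    then show "value_fun S x \<le> A + crit * T" using \<open>S \<le> T\<close> by (rule value_fun_le) }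
qed

definition weak_kam :: "real^'n \<Rightarrow> real" where
  "weak_kam x = (SUP S. value_fun S x)"

lemma value_fun_bdd_above: "bdd_above (range (\<lambda>S. value_fun S x))"
proof -
  obtain B where "\<And>S x. value_fun S x \<le> B" using value_fun_bounded by blast
  then show ?thesis by (intro bdd_aboveI2[of _ _ B])
qed

lemma value_fun_le_weak_kam: "value_fun S x \<le> weak_kam x"
  unfolding weak_kam_def by (rule cSUP_upper[OF _ value_fun_bdd_above]) simp

lemma weak_kam_dominated: "dominated weak_kam"
  unfolding dominated_def
proof (intro allI impI)
  fix x v t K
  assume t: "0 \<le> t" and K: "\<forall>s. 0 \<le> s \<longrightarrow> s \<le> t \<longrightarrow> LP (x + s *\<^sub>R v) v \<le> K"
  have "value_fun S x \<le> t * (K + crit) + weak_kam (x + t *\<^sub>R v)" for S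
    using dominatedD[OF value_fun_dominated[of S] t, of x v K] K value_fun_le_weak_kam[of S "x + t *\<^sub>R v"]
    by force
  then show "weak_kam x \<le> t * (K + crit) + weak_kam (x + t *\<^sub>R v)"
    unfolding weak_kam_def[of x] by (intro cSUP_least) auto
qed

lemma weak_kam_periodic: "zn_periodic weak_kam"
  unfolding zn_periodic_def weak_kam_def using value_fun_periodic by (simp add: zn_periodic_def)

text \<open>Dini's argument: monotone convergence on a finite net of the unit box, extended by the
  common Lipschitz constant and by periodicity.\<close>

lemma value_fun_uniform:
  assumes "0 < \<kappa>"
  obtains S where "0 < S" "\<And>x. weak_kam x - \<kappa> \<le> value_fun S x"
proof -
  obtain \<Lambda> where \<Lambda>: "0 < \<Lambda>" "\<And>w x y. dominated w \<Longrightarrow> \<bar>w x - w y\<bar> \<le> \<Lambda> * dist x y"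
    using dominated_lipschitz by metis
  \<comment> \<open>Moving to a net point costs \<open>\<kappa> / 4\<close> for each of the two
    functions; the remaining \<open>\<kappa> / 2\<close> is the error allowed at the net
    point.\<close>
  define r where "r = \<kappa> / (4 * \<Lambda>)"
  have r: "0 < r" using assms \<Lambda> by (simp add: r_def)
  have "cbox 0 (1::real^'n) \<subseteq> (\<Union>y\<in>cbox 0 1. ball y r)" using r by force
  then obtain N where N: "N \<subseteq> cbox 0 (1::real^'n)" "finite N" "cbox 0 1 \<subseteq> (\<Union>y\<in>N. ball y r)"
    by (rule compactE_image[OF compact_cbox open_ball])
  have "\<exists>S. weak_kam y - \<kappa> / 2 < value_fun S y" for y
    using less_cSUP_iff[OF _ value_fun_bdd_above, of "weak_kam y - \<kappa> / 2" y] assms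
    by (auto simp: weak_kam_def)
  then obtain S where S: "\<And>y. weak_kam y - \<kappa> / 2 < value_fun (S y) y" by metis
  define S' where "S' = Max (insert 1 (S ` N))"
  have S': "1 \<le> S'" "\<And>y. y \<in> N \<Longrightarrow> S y \<le> S'" using N(2) by (auto simp: S'_def)
  have "weak_kam x - \<kappa> \<le> value_fun S' x" for x
  proof -
    have "torus_rep x \<in> cbox 0 1" using torus_rep_in fund_dom_cbox by blast
    then obtain y where y: "y \<in> N" "dist (torus_rep x) y < r" using N(3) by (force simp: dist_commute)
    have "\<Lambda> * dist (torus_rep x) y \<le> \<Lambda> * r" using y \<Lambda> by (intro mult_left_mono) auto
    then have "\<Lambda> * dist (torus_rep x) y \<le> \<kappa> / 4" using \<Lambda> by (simp add: r_def)
    moreover have "\<bar>weak_kam (torus_rep x) - weak_kam y\<bar> \<le> \<Lambda> * dist (torus_rep x) y"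
      "\<bar>value_fun S' (torus_rep x) - value_fun S' y\<bar> \<le> \<Lambda> * dist (torus_rep x) y"
      using \<Lambda>(2) weak_kam_dominated value_fun_dominated by blast+
    moreover have "value_fun (S y) y \<le> value_fun S' y" by (rule value_fun_mono[OF S'(2)[OF y(1)]])
    ultimately have "weak_kam (torus_rep x) - \<kappa> \<le> value_fun S' (torus_rep x)"
      using S[of y] by linarith
    then show ?thesis
      using zn_periodic_torus_rep[OF weak_kam_periodic] zn_periodic_torus_rep[OF value_fun_periodic] by metis
  qed
  then show ?thesis using that[of S'] S'(1) by auto
qed

text \<open>Were the supersolution inequality violated at \<open>x0\<close>, one could lift the weak KAM solution
  near \<open>x0\<close> by a bump \<open>\<beta>\<close> growing in time up to height \<open>\<kappa>\<close> without losing domination, so that all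
  long curves from \<open>x0\<close> would have excess at least \<open>weak_kam x0 + \<kappa> / 2\<close>.\<close>

lemma weak_kam_visc_super: "visc_super H P crit weak_kam"
  unfolding visc_super_def
proof (intro allI impI, elim conjE exE)
  fix \<phi> x0 e
  assume \<phi>: "C1_fun \<phi>" and e: "0 < e" "\<forall>y. dist y x0 < e \<longrightarrow> weak_kam y - \<phi> y \<ge> weak_kam x0 - \<phi> x0"
  show "crit \<le> H x0 (P + grad \<phi> x0)"
  proof (rule ccontr)
    assume neg: "\<not> ?thesis"
    \<comment> \<open>The square makes the contact at \<open>x0\<close> strict without changing the
      gradient there, and the constant makes \<open>\<psi>\<close> agree with
      \<open>weak_kam\<close> at \<open>x0\<close>.\<close>
    define \<psi> where "\<psi> = (\<lambda>x. \<phi> x - (x - x0) \<bullet> (x - x0) + (weak_kam x0 - \<phi> x0))"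
    have der: "(\<psi> has_derivative (\<lambda>w. (grad \<phi> x - 2 *\<^sub>R (x - x0)) \<bullet> w)) (at x)" for x
      unfolding \<psi>_def
      by (auto intro!: derivative_eq_intros C1_funD(1)[OF \<phi>] simp: fun_eq_iff inner_diff_left inner_diff_right inner_commute)
    have cont: "continuous_on UNIV (\<lambda>x. grad \<phi> x - 2 *\<^sub>R (x - x0))"
      by (intro continuous_intros C1_funD[OF \<phi>])
    note \<psi> = C1_funI[OF der cont]
    have "continuous_on UNIV (\<lambda>x. H x (P + grad \<psi> x))"
      unfolding \<psi>(2) by (intro continuous_intros cont)
    then have lim: "((\<lambda>x. H x (P + grad \<psi> x)) \<longlongrightarrow> H x0 (P + grad \<psi> x0)) (at x0)"
      unfolding continuous_on_def by blast
    define \<eta> where "\<eta> = (crit - H x0 (P + grad \<psi> x0)) / 2"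
    have "H x0 (P + grad \<psi> x0) < crit" using neg by (simp add: \<psi>(2))
    then have \<eta>: "0 < \<eta>" "H x0 (P + grad \<psi> x0) < crit - \<eta>" by (auto simp: \<eta>_def field_simps)
    obtain d where d: "0 < d" "\<And>x. x \<noteq> x0 \<Longrightarrow> dist x x0 < d \<Longrightarrow> H x (P + grad \<psi> x) < crit - \<eta>"
      using order_tendstoD(2)[OF lim \<eta>(2)] unfolding eventually_at by auto
    define r where "r = min d e"
    have r: "0 < r" "r \<le> e" using d e by (auto simp: r_def)
    have sub: "H x (P + grad \<psi> x) \<le> crit - \<eta>" if "dist x x0 < r" for x
      using d(2)[of x] \<eta>(2) that by (cases "x = x0") (auto simp: r_def)
    have above: "\<psi> x + (dist x x0)\<^sup>2 \<le> weak_kam x" if "dist x x0 < r" for x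
    proof -
      have "weak_kam x0 - \<phi> x0 \<le> weak_kam x - \<phi> x" using e(2) that r(2) by simp
      then show ?thesis by (simp add: \<psi>_def dist_norm power2_norm_eq_inner)
    qed
    \<comment> \<open>At distance at least \<open>r / 2\<close> the strict contact leaves a gap of
      at least \<open>r\<^sup>2 / 4\<close>, so a lift by \<open>\<kappa>\<close> stays below
      \<open>weak_kam\<close> there and the patched function has no jump at the edge of the
      ball.\<close>
    define \<kappa> where "\<kappa> = r\<^sup>2 / 8"
    have \<kappa>: "0 < \<kappa>" using r by (simp add: \<kappa>_def)
    \<comment> \<open>\<open>\<tau>\<close> is the time remaining before a final stretch of duration
      \<open>S\<close>. The lift may grow at rate \<open>\<eta>\<close> because
      \<open>\<psi>\<close> is locally a subsolution at level \<open>crit - \<eta>\<close>.\<close>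
    define \<beta> where "\<beta> = (\<lambda>\<tau> x. if dist x x0 < r then max (weak_kam x) (\<psi> x + min \<kappa> (\<eta> * \<tau>)) else weak_kam x)"
    have \<beta>_ge: "weak_kam x \<le> \<beta> \<tau> x" for \<tau> x by (simp add: \<beta>_def)
    have \<beta>_0: "\<beta> 0 x = weak_kam x" for x
    proof -
      have "\<psi> x \<le> weak_kam x" if "dist x x0 < r" using above[OF that] by (smt (verit) zero_le_power2)
      then show ?thesis using \<kappa> by (auto simp: \<beta>_def)
    qed
    have far: "\<psi> x + \<kappa> \<le> weak_kam x" if "dist x x0 < r" "r / 2 \<le> dist x x0" for x
    proof -
      have "(r / 2)\<^sup>2 \<le> (dist x x0)\<^sup>2" using that r by (intro power_mono) auto
      moreover have "\<kappa> \<le> (r / 2)\<^sup>2" by (simp add: \<kappa>_def power_divide)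
      ultimately show ?thesis using above[OF that(1)] by linarith
    qed
    have \<beta>_step: "\<beta> (\<tau> + t) x \<le> t * (K + crit) + \<beta> \<tau> (x + t *\<^sub>R v)"
      if \<tau>: "0 \<le> \<tau>" and t: "0 \<le> t" and K: "\<And>s. 0 \<le> s \<Longrightarrow> s \<le> t \<Longrightarrow> LP (x + s *\<^sub>R v) v \<le> K" for \<tau> t x v K
    proof (cases "dist x x0 < r \<and> weak_kam x < \<psi> x + min \<kappa> (\<eta> * (\<tau> + t))")
      case False
      then have "\<beta> (\<tau> + t) x = weak_kam x" by (auto simp: \<beta>_def)
      also have "\<dots> \<le> t * (K + crit) + weak_kam (x + t *\<^sub>R v)"
        by (rule dominatedD[OF weak_kam_dominated t K])
      finally show ?thesis using \<beta>_ge[of "x + t *\<^sub>R v" \<tau>] by linarith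
    next
      case True
      then have x: "dist x x0 < r" and eq: "\<beta> (\<tau> + t) x = \<psi> x + min \<kappa> (\<eta> * (\<tau> + t))"
        by (auto simp: \<beta>_def)
      have near: "dist x x0 < r / 2" using far[OF x] True by linarith
      have seg: "\<psi> x \<le> s * (K + (crit - \<eta>)) + \<psi> (x + s *\<^sub>R v)"
        if s: "0 \<le> s" "s \<le> t" "dist (x + s *\<^sub>R v) x0 < r" for s
      proof (rule C1_subsolution_segment[OF \<psi>(1) s(1)])
        fix s' assume s': "0 \<le> s'" "s' \<le> s"
        show "LP (x + s' *\<^sub>R v) v \<le> K" using K s' s by auto
        have "closed_segment x (x + s *\<^sub>R v) \<subseteq> ball x0 r"
          using x s by (intro closed_segment_subset convex_ball) (auto simp: dist_commute)
        moreover have "x + s' *\<^sub>R v \<in> closed_segment x (x + s *\<^sub>R v)"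
        proof (cases "s = 0")
          case False
          then show ?thesis using s' s(1) unfolding closed_segment_def
            by (auto intro!: exI[of _ "s' / s"] simp: algebra_simps scaleR_add_left[symmetric] simp del: scaleR_add_left)
        qed (use s' in auto)
        ultimately show "H (x + s' *\<^sub>R v) (P + grad \<psi> (x + s' *\<^sub>R v)) \<le> crit - \<eta>"
          by (intro sub) (auto simp: dist_commute)
      qed
      show ?thesis
      proof (cases "dist (x + t *\<^sub>R v) x0 < r")
        case True
        have "0 \<le> \<eta> * t" using \<eta> t by simp
        then have "min \<kappa> (\<eta> * (\<tau> + t)) \<le> min \<kappa> (\<eta> * \<tau>) + \<eta> * t"
          by (auto simp: min_def algebra_simps)
        moreover have "\<psi> (x + t *\<^sub>R v) + min \<kappa> (\<eta> * \<tau>) \<le> \<beta> \<tau> (x + t *\<^sub>R v)"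
          using True by (simp add: \<beta>_def)
        ultimately show ?thesis using seg[OF t _ True] eq by (simp add: algebra_simps)
      next
        case False
        \<comment> \<open>A segment leaving the ball crosses the sphere of radius
          \<open>r / 2\<close>, where the lift is already invisible; from there domination of
          \<open>weak_kam\<close> takes over.\<close>
        have "\<exists>s. 0 \<le> s \<and> s \<le> t \<and> dist (x + s *\<^sub>R v) x0 = r / 2"
        proof (rule IVT'[of "\<lambda>s. dist (x + s *\<^sub>R v) x0"])
          show "continuous_on {0..t} (\<lambda>s. dist (x + s *\<^sub>R v) x0)" by (intro continuous_intros)
        qed (use near False t r in auto)
        then obtain s where s: "0 \<le> s" "s \<le> t" "dist (x + s *\<^sub>R v) x0 = r / 2" by blast
        have "\<psi> x \<le> s * (K + (crit - \<eta>)) + \<psi> (x + s *\<^sub>R v)"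
          by (rule seg[OF s(1,2)]) (use s r in auto)
        moreover have "s * (K + (crit - \<eta>)) \<le> s * (K + crit)" using s \<eta> by (intro mult_left_mono) auto
        moreover have "\<psi> (x + s *\<^sub>R v) + \<kappa> \<le> weak_kam (x + s *\<^sub>R v)"
          by (rule far) (use s r in auto)
        moreover have "weak_kam (x + s *\<^sub>R v) \<le> (t - s) * (K + crit) + weak_kam (x + s *\<^sub>R v + (t - s) *\<^sub>R v)"
        proof (rule dominatedD[OF weak_kam_dominated])
          fix s' assume "0 \<le> s'" "s' \<le> t - s"
          then show "LP (x + s *\<^sub>R v + s' *\<^sub>R v) v \<le> K" using K[of "s + s'"] s by (simp add: algebra_simps)
        qed (use s in auto)
        moreover have "x + s *\<^sub>R v + (t - s) *\<^sub>R v = x + t *\<^sub>R v" by (simp add: algebra_simps)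
        ultimately show ?thesis using eq \<beta>_ge[of "x + t *\<^sub>R v" \<tau>] by (simp add: algebra_simps)
      qed
    qed
    obtain S where S: "0 < S" "\<And>x. weak_kam x - \<kappa> / 2 \<le> value_fun S x"
      using value_fun_uniform[of "\<kappa> / 2"] \<kappa> by auto
    \<comment> \<open>Domination of \<open>\<beta>\<close> is iterated until duration
      \<open>S\<close> is left; the remainder is compared with \<open>value_fun S\<close>, which
      costs \<open>\<kappa> / 2\<close>.\<close>
    have chain: "\<beta> (T - S) x - \<kappa> / 2 \<le> A + crit * T" if "reach x y T A" "S \<le> T" for x y T A
      using that
    proof (induction rule: reach.induct)
      case (step t x v K y T A)
      show ?case
      proof (cases "S \<le> T")
        case True
        have "\<beta> (T - S + t) x \<le> t * (K + crit) + \<beta> (T - S) (x + t *\<^sub>R v)"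
          by (rule \<beta>_step[OF _ step(1,2)]) (use True in auto)
        then show ?thesis using step.IH[OF True] by (simp add: algebra_simps)
      next
        case False
        \<comment> \<open>The part of the segment lying before the final stretch of duration
          \<open>S\<close>.\<close>
        define s where "s = t + T - S"
        have s: "0 \<le> s" "s \<le> t" using step.prems False by (auto simp: s_def)
        have "LP (x + s *\<^sub>R v + s' *\<^sub>R v) v \<le> K" if "0 \<le> s'" "s' \<le> t - s" for s'
          using step(2)[of "s + s'"] that s by (simp add: algebra_simps)
        then have "reach (x + s *\<^sub>R v) y ((t - s) + T) ((t - s) * K + A)"
          using s step(3) by (intro reach.step) (auto simp: algebra_simps)
        from value_fun_le[OF this, of S]
        have "value_fun S (x + s *\<^sub>R v) \<le> (t - s) * K + A + crit * S" by (simp add: s_def)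
        moreover have "\<beta> (0 + s) x \<le> s * (K + crit) + \<beta> 0 (x + s *\<^sub>R v)"
          by (rule \<beta>_step) (use s step(2) in auto)
        moreover have "crit * S = crit * (t + T) - s * crit" by (simp add: s_def algebra_simps)
        ultimately have "\<beta> s x - \<kappa> / 2 \<le> t * K + A + crit * (t + T)"
          using S(2)[of "x + s *\<^sub>R v"] \<beta>_0[of "x + s *\<^sub>R v"] by (simp add: algebra_simps)
        then show ?thesis by (simp add: s_def)
      qed
    qed (use S in auto)
    \<comment> \<open>The lift needs the extra time \<open>\<kappa> / \<eta>\<close> to grow to its
      full height \<open>\<kappa>\<close>.\<close>
    define S' where "S' = S + \<kappa> / \<eta>"
    have "weak_kam x0 + \<kappa> / 2 \<le> value_fun S' x0"
    proof (rule value_fun_greatest)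
      fix y T A assume T: "reach x0 y T A" "S' \<le> T"
      have "0 \<le> \<kappa> / \<eta>" using \<kappa> \<eta> by simp
      then have "S \<le> T" using T(2) by (simp add: S'_def)
      moreover have "\<kappa> \<le> \<eta> * (T - S)" using T(2) \<eta> by (simp add: S'_def field_simps)
      then have "weak_kam x0 + \<kappa> \<le> \<beta> (T - S) x0" using r by (simp add: \<beta>_def \<psi>_def)
      ultimately show "weak_kam x0 + \<kappa> / 2 \<le> A + crit * T" using chain[OF T(1)] by linarith
    qed
    then show False using value_fun_le_weak_kam[of S' x0] \<kappa> by linarith
  qed
qed

lemma weak_kam_visc_sol: "visc_sol H P crit weak_kam"
  unfolding visc_sol_def
  using dominated_continuous[OF weak_kam_dominated] dominated_visc_sub[OF weak_kam_dominated]
    weak_kam_visc_super by blast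

end

subsection \<open>Smooth approximate subsolutions\<close>

text \<open>A truncated polynomial kernel: C^1 regularity suffices, and its explicit quadratic
  Taylor error makes differentiation under the integral elementary. Normalization is postponed to
  the mollification.\<close>

definition bump :: "real \<Rightarrow> 'a::euclidean_space \<Rightarrow> real" where
  "bump r z = (max 0 (r\<^sup>2 - z \<bullet> z))\<^sup>2"

text \<open>Minus the gradient of \<open>bump r\<close>, that is, the derivative of
  \<open>bump r (y - x)\<close> in \<open>x\<close> at \<open>z = y - x\<close>.\<close>

definition dbump :: "real \<Rightarrow> 'a::euclidean_space \<Rightarrow> 'a" where
  "dbump r z = (4 * max 0 (r\<^sup>2 - z \<bullet> z)) *\<^sub>R z"

lemma bump_nonneg: "0 \<le> bump r z"
  by (simp add: bump_def)

lemma bump_continuous: "continuous_on S (bump r)"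
  and dbump_continuous: "continuous_on S (dbump r)"
  unfolding bump_def dbump_def by (intro continuous_intros)+

lemma bump_outside:
  assumes "0 < r" "r < norm z"
  shows "bump r z = 0" "dbump r z = 0"
proof -
  have "r\<^sup>2 \<le> (norm z)\<^sup>2" using assms by (intro power_mono) auto
  then have "max 0 (r\<^sup>2 - z \<bullet> z) = 0" by (simp add: power2_norm_eq_inner)
  then show "bump r z = 0" "dbump r z = 0" by (simp_all add: bump_def dbump_def)
qed

text \<open>The derivative \<open>2 * max 0 a\<close> is Lipschitz with constant 2, hence error
  constant 1 even when \<open>a\<close> and \<open>b\<close> have different signs.\<close>

lemma pos_part_square_taylor:
  fixes a b :: real
  shows "\<bar>(max 0 b)\<^sup>2 - (max 0 a)\<^sup>2 - 2 * max 0 a * (b - a)\<bar> \<le> (b - a)\<^sup>2"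
proof (cases "0 \<le> a"; cases "0 \<le> b")
  assume "0 \<le> a" "\<not> 0 \<le> b"
  then have "a * b \<le> 0" by (simp add: mult_nonneg_nonpos)
  moreover have "0 \<le> a\<^sup>2" "0 \<le> b\<^sup>2" by simp_all
  ultimately have "\<bar>a\<^sup>2 - 2 * (a * b)\<bar> \<le> a\<^sup>2 - 2 * (a * b) + b\<^sup>2" by linarith
  then show ?thesis using \<open>0 \<le> a\<close> \<open>\<not> 0 \<le> b\<close>
    by (simp add: power2_eq_square algebra_simps)
next
  assume ab: "\<not> 0 \<le> a" "0 \<le> b"
  then have "a * b \<le> 0" by (simp add: mult_nonpos_nonneg)
  moreover have "0 \<le> a\<^sup>2" by simp
  moreover have "(b - a)\<^sup>2 = b\<^sup>2 - 2 * (a * b) + a\<^sup>2" by (simp add: power2_eq_square algebra_simps)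
  ultimately have "b\<^sup>2 \<le> (b - a)\<^sup>2" by linarith
  then show ?thesis using ab by simp
next
  assume "0 \<le> a" "0 \<le> b"
  then have "(max 0 b)\<^sup>2 - (max 0 a)\<^sup>2 - 2 * max 0 a * (b - a) = (b - a)\<^sup>2"
    by (simp add: power2_eq_square algebra_simps)
  then show ?thesis by simp
qed simp

text \<open>With \<open>d\<close> the increment of \<open>r\<^sup>2 - z \<bullet> z\<close>, the
  first constant comes from \<open>\<bar>d\<bar> \<le> (2 * r + 3) * norm h\<close> and the second
  from the part of \<open>d\<close> quadratic in \<open>h\<close>. The support grows by 1 because
  \<open>norm h \<le> 1\<close>.\<close>

lemma bump_taylor:
  fixes z h :: "'a::euclidean_space"
  assumes "0 < r" "norm h \<le> 1"
  shows "\<bar>bump r (z - h) - bump r z - dbump r z \<bullet> h\<bar> \<le> ((2 * r + 3)\<^sup>2 + 2 * r\<^sup>2) * (norm h)\<^sup>2 * indicator (cball 0 (r + 1)) z"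
proof (cases "norm z \<le> r + 1")
  case False
  then have "r < norm (z - h)" "r < norm z" using norm_triangle_ineq2[of z h] assms by linarith+
  then have "bump r (z - h) = 0" "bump r z = 0" "dbump r z = 0"
    using bump_outside[OF assms(1)] by blast+
  then show ?thesis using assms(1) by simp
next
  case True
  define a where "a = r\<^sup>2 - z \<bullet> z"
  define d where "d = 2 * (z \<bullet> h) - h \<bullet> h"
  have b: "r\<^sup>2 - (z - h) \<bullet> (z - h) = a + d"
    by (simp add: a_def d_def inner_diff_left inner_diff_right inner_commute)
  have "\<bar>(max 0 (a + d))\<^sup>2 - (max 0 a)\<^sup>2 - 2 * max 0 a * d\<bar> \<le> d\<^sup>2"
    using pos_part_square_taylor[of "a + d" a] by simp
  moreover have "dbump r z \<bullet> h = 2 * max 0 a * d + 2 * max 0 a * (h \<bullet> h)"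
    by (simp add: dbump_def a_def d_def algebra_simps)
  moreover have "\<bar>2 * max 0 a * (h \<bullet> h)\<bar> \<le> 2 * r\<^sup>2 * (h \<bullet> h)"
  proof -
    have "max 0 a \<le> r\<^sup>2" by (simp add: a_def)
    then have "max 0 a * (h \<bullet> h) \<le> r\<^sup>2 * (h \<bullet> h)" by (intro mult_right_mono) auto
    then show ?thesis by simp
  qed
  moreover have "d\<^sup>2 \<le> (2 * r + 3)\<^sup>2 * (norm h)\<^sup>2"
  proof -
    have "\<bar>z \<bullet> h\<bar> \<le> norm z * norm h" by (rule Cauchy_Schwarz_ineq2)
    also have "\<dots> \<le> (r + 1) * norm h" using True by (intro mult_right_mono) auto
    finally have 1: "\<bar>z \<bullet> h\<bar> \<le> (r + 1) * norm h" .
    have "norm h * norm h \<le> 1 * norm h" using assms by (intro mult_right_mono) auto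
    then have 2: "0 \<le> h \<bullet> h" "h \<bullet> h \<le> norm h"
      by (simp_all add: power2_norm_eq_inner[symmetric] power2_eq_square)
    have "\<bar>d\<bar> \<le> 2 * ((r + 1) * norm h) + norm h" using 1 2 unfolding d_def by linarith
    also have "\<dots> = (2 * r + 3) * norm h" by (simp add: algebra_simps)
    finally have "\<bar>d\<bar>\<^sup>2 \<le> ((2 * r + 3) * norm h)\<^sup>2" by (intro power_mono) auto
    then show ?thesis by (simp add: power_mult_distrib)
  qed
  ultimately have "\<bar>(max 0 (a + d))\<^sup>2 - (max 0 a)\<^sup>2 - dbump r z \<bullet> h\<bar> \<le> (2 * r + 3)\<^sup>2 * (norm h)\<^sup>2 + 2 * r\<^sup>2 * (h \<bullet> h)"
    by linarith
  then show ?thesis using True b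
    by (simp add: bump_def a_def power2_norm_eq_inner algebra_simps)
qed

lemma has_derivative_quadratic_error:
  fixes f :: "'a::real_normed_vector \<Rightarrow> real"
  assumes "bounded_linear D" "\<And>h. norm h \<le> 1 \<Longrightarrow> \<bar>f (x + h) - f x - D h\<bar> \<le> C * (norm h)\<^sup>2"
  shows "(f has_derivative D) (at x)"
  unfolding has_derivative_at
proof (intro conjI assms(1))
  have lim: "((\<lambda>h::'a. C * norm h) \<longlongrightarrow> 0) (at 0)"
    by (auto intro!: tendsto_eq_intros)
  show "(\<lambda>h. norm (f (x + h) - f x - D h) / norm h) \<midarrow>0\<rightarrow> 0"
  proof (rule tendsto_sandwich[OF _ _ tendsto_const lim])
    show "\<forall>\<^sub>F h in at 0. norm (f (x + h) - f x - D h) / norm h \<le> C * norm h"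
      unfolding eventually_at
    proof (intro exI[of _ 1] conjI ballI impI)
      fix h :: 'a assume "h \<noteq> 0 \<and> dist h 0 < 1"
      then show "norm (f (x + h) - f x - D h) / norm h \<le> C * norm h"
        using assms(2)[of h] by (simp add: field_simps power2_eq_square)
    qed simp
  qed simp
qed

lemma lborel_has_bochner_integral_translate:
  fixes f :: "'a::euclidean_space \<Rightarrow> 'b::{banach, second_countable_topology}"
  assumes "has_bochner_integral lborel f I"
  shows "has_bochner_integral lborel (\<lambda>y. f (c + y)) I"
proof -
  have f: "f \<in> borel_measurable borel" using assms by (auto dest: borel_measurable_has_bochner_integral)
  have "has_bochner_integral (distr lborel borel ((+) c)) f I"
    using assms by (simp add: lborel_distr_plus)
  then show ?thesis using f
    by (simp add: has_bochner_integral_iff integrable_distr_eq integral_distr)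
qed

lemma integrable_compact_support:
  fixes f :: "'a::euclidean_space \<Rightarrow> 'b::{banach, second_countable_topology}"
  assumes "continuous_on UNIV f" "\<And>y. R < norm (y - c) \<Longrightarrow> f y = 0"
  shows "integrable lborel f"
proof -
  have "integrable lborel (\<lambda>x. indicator (cball c R) x *\<^sub>R f x)"
    by (intro borel_integrable_compact compact_cball continuous_on_subset[OF assms(1)]) auto
  also have "(\<lambda>x. indicator (cball c R) x *\<^sub>R f x) = f"
    using assms(2) by (force simp: indicator_def dist_norm norm_minus_commute)
  finally show ?thesis .
qed

lemma bump_integral_pos:
  assumes "0 < r"
  shows "0 < integral\<^sup>L lborel (bump r :: 'a::euclidean_space \<Rightarrow> real)"
proof -
  let ?c = "((3 / 4) * r\<^sup>2)\<^sup>2"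
  have "0 < ?c * measure lborel (ball (0::'a) (r / 2))"
    using assms content_ball_pos[of "r / 2" "0::'a"] by simp
  also have "\<dots> = integral\<^sup>L lborel (\<lambda>z::'a. ?c * indicator (ball 0 (r / 2)) z)" by simp
  also have "\<dots> \<le> integral\<^sup>L lborel (bump r :: 'a \<Rightarrow> real)"
  proof (rule integral_mono)
    show "integrable lborel (\<lambda>z::'a. ?c * indicator (ball 0 (r / 2)) z)"
      by (intro integrable_mult_right integrable_real_indicator)
        (auto simp: emeasure_bounded_finite[unfolded infinity_ennreal_def])
    show "integrable lborel (bump r :: 'a \<Rightarrow> real)"
      by (rule integrable_compact_support[where R=r and c=0]) (simp_all add: bump_continuous bump_outside assms)
    fix z :: 'a
    show "?c * indicator (ball 0 (r / 2)) z \<le> bump r z"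
    proof (cases "norm z < r / 2")
      case True
      have "(norm z)\<^sup>2 \<le> (r / 2)\<^sup>2" using True by (intro power_mono) auto
      then have "(3 / 4) * r\<^sup>2 \<le> r\<^sup>2 - z \<bullet> z" by (simp add: power2_norm_eq_inner power_divide)
      then have "(3 / 4) * r\<^sup>2 \<le> max 0 (r\<^sup>2 - z \<bullet> z)" by linarith
      then have "?c \<le> bump r z" unfolding bump_def by (intro power_mono) auto
      then show ?thesis using True by simp
    qed (simp add: bump_nonneg)
  qed
  finally show ?thesis .
qed

text \<open>Inside the proof the variable sits in the kernel, where it can be differentiated. The
  result is stated as an average of translates of \<open>u\<close>, the form to which pointwise
  inequalities between translates apply.\<close>

lemma mollification:
  fixes u :: "'a::euclidean_space \<Rightarrow> real"
  assumes lip: "\<And>x y. \<bar>u x - u y\<bar> \<le> \<Lambda> * dist x y" and bdd: "\<And>x. \<bar>u x\<bar> \<le> B" and r: "0 < r"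
  obtains w \<rho> where "C1_fun w" "\<And>x. has_bochner_integral lborel (\<lambda>y. \<rho> y * u (x + y)) (w x)"
    "\<And>y. 0 \<le> \<rho> y" "has_bochner_integral lborel \<rho> 1" "\<And>y. r < norm y \<Longrightarrow> \<rho> y = 0"
proof -
  have "0 \<le> \<Lambda>"
  proof (rule ccontr)
    assume "\<not> ?thesis"
    obtain b :: 'a where "b \<in> Basis" using nonempty_Basis by blast
    then show False using lip[of b 0] \<open>\<not> 0 \<le> \<Lambda>\<close> by simp
  qed
  then have "\<Lambda>-lipschitz_on UNIV u"
    by (intro lipschitz_onI) (auto simp: dist_real_def lip)
  then have ucont: "continuous_on UNIV u" by (rule lipschitz_on_continuous_on)
  have ucont': "continuous_on S (\<lambda>y. u (g y))" if "continuous_on S g" for S :: "'a set" and g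
    using continuous_on_compose2[OF ucont that] by simp
  let ?k = "bump r :: 'a \<Rightarrow> real" and ?G = "dbump r :: 'a \<Rightarrow> 'a"
  have kc: "continuous_on S (\<lambda>y. ?k (g y))" "continuous_on S (\<lambda>y. ?G (g y))" if "continuous_on S g" for S :: "'a set" and g
    using continuous_on_compose2[OF bump_continuous[of UNIV] that]
      continuous_on_compose2[OF dbump_continuous[of UNIV] that] by auto
  define Z where "Z = integral\<^sup>L lborel ?k"
  have Z: "0 < Z" unfolding Z_def by (rule bump_integral_pos[OF r])
  define W where "W = (\<lambda>x. integral\<^sup>L lborel (\<lambda>y. ?k (y - x) * u y))"
  define D where "D = (\<lambda>x. integral\<^sup>L lborel (\<lambda>y. u y *\<^sub>R ?G (y - x)))"
  have k_int: "integrable lborel ?k"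
    by (rule integrable_compact_support[where R=r and c=0]) (simp_all add: bump_continuous bump_outside r)
  have W_int: "integrable lborel (\<lambda>y. ?k (y - x) * u y)" for x
    by (rule integrable_compact_support[where R=r and c=x])
      (auto intro!: continuous_intros kc ucont' simp: bump_outside r)
  have D_int: "integrable lborel (\<lambda>y. u y *\<^sub>R ?G (y - x))" for x
    by (rule integrable_compact_support[where R=r and c=x])
      (auto intro!: continuous_intros kc ucont' simp: bump_outside r)
  have W_trans: "has_bochner_integral lborel (\<lambda>y. ?k y * u (x + y)) (W x)" for x
  proof -
    have "has_bochner_integral lborel (\<lambda>y. ?k (y - x) * u y) (W x)"
      unfolding W_def by (rule has_bochner_integral_integrable[OF W_int])
    from lborel_has_bochner_integral_translate[OF this, of x] show ?thesis by simp
  qed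
  have D_trans: "has_bochner_integral lborel (\<lambda>y. u (x + y) *\<^sub>R ?G y) (D x)" for x
  proof -
    have "has_bochner_integral lborel (\<lambda>y. u y *\<^sub>R ?G (y - x)) (D x)"
      unfolding D_def by (rule has_bochner_integral_integrable[OF D_int])
    from lborel_has_bochner_integral_translate[OF this, of x] show ?thesis by simp
  qed
  let ?C = "(2 * r + 3)\<^sup>2 + 2 * r\<^sup>2"
  let ?V = "measure lborel (cball (0::'a) (r + 1))"
  have W_der: "(W has_derivative (\<lambda>h. D x \<bullet> h)) (at x)" for x
  proof (rule has_derivative_quadratic_error[where C="?C * B * ?V"])
    show "bounded_linear (\<lambda>h. D x \<bullet> h)" by (rule bounded_linear_inner_right)
    fix h :: 'a assume h: "norm h \<le> 1"
    let ?e = "\<lambda>y. (?k (y - x - h) - ?k (y - x) - ?G (y - x) \<bullet> h) * u y"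
    have e_int: "has_bochner_integral lborel ?e (W (x + h) - W x - D x \<bullet> h)"
    proof -
      have "has_bochner_integral lborel (\<lambda>y. ?k (y - (x + h)) * u y - ?k (y - x) * u y - (u y *\<^sub>R ?G (y - x)) \<bullet> h)
          (W (x + h) - W x - D x \<bullet> h)"
        unfolding W_def D_def
        by (intro has_bochner_integral_diff has_bochner_integral_inner_left has_bochner_integral_integrable W_int D_int)
      then show ?thesis by (simp add: algebra_simps)
    qed
    let ?b = "\<lambda>y. (?C * (norm h)\<^sup>2 * B) * indicator (cball x (r + 1)) y :: real"
    have "norm (?e y) \<le> ?b y" for y
    proof -
      have "0 \<le> B" using bdd[of x] by linarith
      have "\<bar>?e y\<bar> \<le> (?C * (norm h)\<^sup>2 * indicator (cball 0 (r + 1)) (y - x)) * B"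
        unfolding abs_mult by (intro mult_mono bump_taylor r h bdd) (auto simp: indicator_def)
      then show ?thesis by (auto simp: indicator_def dist_norm norm_minus_commute)
    qed
    moreover have "integrable lborel ?b"
      by (intro integrable_mult_right integrable_real_indicator) (auto simp: emeasure_bounded_finite[unfolded infinity_ennreal_def])
    moreover have "integrable lborel ?e" using e_int by (simp add: has_bochner_integral_iff)
    ultimately have "norm (integral\<^sup>L lborel ?e) \<le> integral\<^sup>L lborel ?b"
      by (intro Bochner_Integration.integral_norm_bound_integral) auto
    moreover have "integral\<^sup>L lborel ?b = ?C * (norm h)\<^sup>2 * B * ?V"
      using r content_ball_conv_unit_ball[of "r + 1" x] by (simp add: content_cball)
    ultimately show "\<bar>W (x + h) - W x - D x \<bullet> h\<bar> \<le> ?C * B * ?V * (norm h)\<^sup>2"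
      unfolding has_bochner_integral_integral_eq[OF e_int] real_norm_def by (simp only: mult_ac)
  qed
  have G_int: "integrable lborel (\<lambda>y. norm (?G y))"
    by (rule integrable_compact_support[where R=r and c=0])
      (auto intro!: continuous_intros kc simp: bump_outside r)
  let ?I = "integral\<^sup>L lborel (\<lambda>y. norm (?G y))"
  \<comment> \<open>For continuity of the derivative the variable is moved back onto
    \<open>u\<close>, whose Lipschitz bound applies.\<close>
  have "(\<Lambda> * ?I)-lipschitz_on UNIV D"
  proof (rule lipschitz_onI)
    show "0 \<le> \<Lambda> * ?I" using \<open>0 \<le> \<Lambda>\<close> by simp
    fix x x' :: 'a
    have *: "has_bochner_integral lborel (\<lambda>y. u (x + y) *\<^sub>R ?G y - u (x' + y) *\<^sub>R ?G y) (D x - D x')"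
      by (intro has_bochner_integral_diff D_trans)
    have "norm (integral\<^sup>L lborel (\<lambda>y. u (x + y) *\<^sub>R ?G y - u (x' + y) *\<^sub>R ?G y)) \<le> integral\<^sup>L lborel (\<lambda>y. (\<Lambda> * dist x x') * norm (?G y))"
    proof (rule Bochner_Integration.integral_norm_bound_integral)
      fix y
      have "\<bar>u (x + y) - u (x' + y)\<bar> \<le> \<Lambda> * dist x x'"
        using lip[of "x + y" "x' + y"] by (simp add: dist_norm)
      then show "norm (u (x + y) *\<^sub>R ?G y - u (x' + y) *\<^sub>R ?G y) \<le> (\<Lambda> * dist x x') * norm (?G y)"
        unfolding scaleR_diff_left[symmetric] norm_scaleR by (intro mult_right_mono) auto
    qed (use * G_int in \<open>auto simp: has_bochner_integral_iff\<close>)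
    then show "dist (D x) (D x') \<le> \<Lambda> * ?I * dist x x'"
      unfolding has_bochner_integral_integral_eq[OF *] by (simp add: dist_norm mult_ac)
  qed
  then have D_cont: "continuous_on UNIV D" by (rule lipschitz_on_continuous_on)
  show ?thesis
  proof (rule that[of "\<lambda>x. W x / Z" "\<lambda>y. ?k y / Z"])
    show "C1_fun (\<lambda>x. W x / Z)"
    proof (rule C1_funI(1))
      show "((\<lambda>x. W x / Z) has_derivative (\<lambda>h. (D x /\<^sub>R Z) \<bullet> h)) (at x)" for x
        using Z by (auto intro!: derivative_eq_intros W_der simp: fun_eq_iff field_simps)
      show "continuous_on UNIV (\<lambda>x. D x /\<^sub>R Z)" by (intro continuous_intros D_cont)
    qed
    show "has_bochner_integral lborel (\<lambda>y. ?k y / Z * u (x + y)) (W x / Z)" for x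
      using has_bochner_integral_divide_zero[OF W_trans[of x], of Z] by simp
    show "0 \<le> ?k y / Z" for y using Z by (simp add: bump_nonneg)
    show "has_bochner_integral lborel (\<lambda>y. ?k y / Z) 1"
      using has_bochner_integral_divide_zero[OF has_bochner_integral_integrable[OF k_int], of Z] Z
      by (simp add: Z_def)
    show "?k y / Z = 0" if "r < norm y" for y using bump_outside[OF r that] by simp
  qed
qed

context cell_problem
begin

text \<open>Averaging the domination inequality over translates replaces Jensen's inequality for
  \<open>H\<close>: the same velocity serves all base points \<open>x + y\<close>, and moving the
  base point changes \<open>LP\<close> by less than \<open>\<epsilon>\<close>.\<close>

lemma C1_critical_subsolution:
  assumes "0 < \<epsilon>"
  obtains w where "C1_fun w" "zn_periodic w" "\<And>x. H x (P + grad w x) \<le> crit + \<epsilon>"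
proof -
  let ?u = weak_kam
  obtain \<Lambda> where \<Lambda>: "0 < \<Lambda>" "\<And>w x y. dominated w \<Longrightarrow> \<bar>w x - w y\<bar> \<le> \<Lambda> * dist x y"
    using dominated_lipschitz by blast
  note lip = \<Lambda>(2)[OF weak_kam_dominated]
  obtain B where bdd: "\<And>x. \<bar>?u x\<bar> \<le> B"
    using periodic_continuous_bounded[OF dominated_continuous[OF weak_kam_dominated] weak_kam_periodic] by blast
  \<comment> \<open>Mollification keeps the Lipschitz constant, so this momentum ball contains every
    \<open>P + grad w x\<close> and \<open>R\<close> bounds all test velocities before
    \<open>w\<close> is chosen.\<close>
  obtain R where R: "\<And>x p. norm p \<le> norm P + \<Lambda> \<Longrightarrow> norm (DH x p) \<le> R" using DH_bounded by blast
  have "norm (0::real^'n) \<le> norm P + \<Lambda>" using \<Lambda>(1) by simp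
  from R[OF this, of 0] have "0 \<le> R" using norm_ge_zero order_trans by blast
  obtain \<delta> where \<delta>: "0 < \<delta>" "\<And>x y v. norm v \<le> R \<Longrightarrow> dist x y < \<delta> \<Longrightarrow> \<bar>LP x v - LP y v\<bar> < \<epsilon>"
    using periodic_equicontinuous[OF LP_continuous LP_periodic assms] by blast
  obtain w \<rho> where w: "C1_fun w" and wi: "\<And>x. has_bochner_integral lborel (\<lambda>y. \<rho> y * ?u (x + y)) (w x)"
    and \<rho>: "\<And>y. 0 \<le> \<rho> y" "has_bochner_integral lborel \<rho> 1" "\<And>y. \<delta> / 2 < norm y \<Longrightarrow> \<rho> y = 0"
    by (rule mollification[OF lip bdd, of "\<delta> / 2"]) (use \<delta>(1) in auto)
  have avg: "w x \<le> b + w x'"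
    if "\<And>y. norm y \<le> \<delta> / 2 \<Longrightarrow> ?u (x + y) \<le> b + ?u (x' + y)" for x x' b
  proof -
    have "has_bochner_integral lborel (\<lambda>y. \<rho> y * b + \<rho> y * ?u (x' + y)) (1 * b + w x')"
      by (intro has_bochner_integral_add has_bochner_integral_mult_left \<rho> wi)
    moreover have "\<rho> y * ?u (x + y) \<le> \<rho> y * b + \<rho> y * ?u (x' + y)" for y
      using mult_left_mono[OF that[of y] \<rho>(1)[of y]] \<rho>(3)[of y]
      by (cases "norm y \<le> \<delta> / 2") (auto simp: algebra_simps)
    ultimately show ?thesis using wi[of x]
      unfolding has_bochner_integral_iff
      using integral_mono[of lborel "\<lambda>y. \<rho> y * ?u (x + y)" "\<lambda>y. \<rho> y * b + \<rho> y * ?u (x' + y)"] by simp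
  qed
  have grad_bound: "norm (grad w x) \<le> \<Lambda>" for x
  proof -
    \<comment> \<open>Testing in the direction of steepest descent recovers the norm of the
      gradient.\<close>
    let ?v = "- grad w x"
    have "- (grad w x \<bullet> ?v) \<le> \<Lambda> * norm ?v"
    proof (rule C1_fun_slope_le[OF w zero_less_one])
      fix t :: real assume "0 < t"
      show "w x \<le> t * (\<Lambda> * norm ?v) + w (x + t *\<^sub>R ?v)"
      proof (rule avg)
        fix y
        show "?u (x + y) \<le> t * (\<Lambda> * norm ?v) + ?u (x + t *\<^sub>R ?v + y)"
          using lip[of "x + y" "x + t *\<^sub>R ?v + y"] \<open>0 < t\<close>
          by (simp add: dist_norm algebra_simps abs_le_iff)
      qed
    qed
    then have "norm (grad w x) * norm (grad w x) \<le> \<Lambda> * norm (grad w x)"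
      by (simp add: dot_square_norm power2_eq_square)
    then show ?thesis using \<Lambda>(1) by (cases "grad w x = 0") auto
  qed
  have "H x (P + grad w x) \<le> crit + \<epsilon>" for x
  proof -
    define p where "p = P + grad w x"
    define v where "v = - DH x p"
    have "norm p \<le> norm P + \<Lambda>" unfolding p_def using grad_bound[of x] norm_triangle_ineq[of P "grad w x"] by linarith
    then have v: "norm v \<le> R" using R by (simp add: v_def)
    \<comment> \<open>Half of \<open>\<delta>\<close> is reserved for the mollification radius and
      half for the drift along the segment.\<close>
    define d where "d = \<delta> / (2 * (R + 1))"
    have d: "0 < d" using \<delta> \<open>0 \<le> R\<close> by (simp add: d_def)
    have "- (grad w x \<bullet> v) \<le> LP x v + \<epsilon> + crit"
    proof (rule C1_fun_slope_le[OF w d])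
      fix t assume t: "0 < t" "t < d"
      show "w x \<le> t * (LP x v + \<epsilon> + crit) + w (x + t *\<^sub>R v)"
      proof (rule avg)
        fix y :: "real^'n" assume y: "norm y \<le> \<delta> / 2"
        have "?u (x + y) \<le> t * (LP x v + \<epsilon> + crit) + ?u (x + y + t *\<^sub>R v)"
        proof (rule dominatedD[OF weak_kam_dominated])
          fix s assume s: "0 \<le> s" "s \<le> t"
          have "s * norm v \<le> t * (R + 1)" using s v t by (intro mult_mono) auto
          also have "\<dots> < d * (R + 1)" using t \<open>0 \<le> R\<close> by (intro mult_strict_right_mono) auto
          also have "\<dots> = \<delta> / 2" using \<open>0 \<le> R\<close> by (simp add: d_def field_simps)
          finally have "norm (s *\<^sub>R v) < \<delta> / 2" using s by simp
          then have "dist (x + y + s *\<^sub>R v) x < \<delta>"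
            using norm_triangle_ineq[of y "s *\<^sub>R v"] y by (simp add: dist_norm)
          from \<delta>(2)[OF v this] show "LP (x + y + s *\<^sub>R v) v \<le> LP x v + \<epsilon>" by linarith
        qed (use t in simp)
        then show "?u (x + y) \<le> t * (LP x v + \<epsilon> + crit) + ?u (x + t *\<^sub>R v + y)"
          by (simp add: algebra_simps)
      qed
    qed
    moreover have "Lagr H x v + H x p = - (p \<bullet> v)"
      using Fenchel_DH[of x p] by (simp add: v_def)
    ultimately show ?thesis unfolding LP_def p_def[symmetric]
      by (simp add: p_def inner_add_left)
  qed
  moreover have "zn_periodic w"
    unfolding zn_periodic_def
  proof (intro allI impI)
    fix x k :: "real^'n" assume "int_vec k"
    then have "?u (x + k + y) = ?u (x + y)" for y
      using zn_periodicD[OF weak_kam_periodic, of k "x + y"] by (simp add: algebra_simps)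
    then show "w (x + k) = w x"
      using wi[of "x + k"] wi[of x] by (simp add: has_bochner_integral_iff)
  qed
  ultimately show ?thesis using that w by blast
qed

end

subsection \<open>Uniqueness of the critical value\<close>

lemma C1_fun_quadratic:
  fixes y :: "'a::euclidean_space"
  shows "C1_fun (\<lambda>x. a * ((x - y) \<bullet> (x - y)))"
    and "grad (\<lambda>x. a * ((x - y) \<bullet> (x - y))) x = (2 * a) *\<^sub>R (x - y)"
proof -
  have der: "((\<lambda>x. a * ((x - y) \<bullet> (x - y))) has_derivative (\<lambda>w. ((2 * a) *\<^sub>R (x - y)) \<bullet> w)) (at x)" for x
    by (auto intro!: derivative_eq_intros simp: fun_eq_iff inner_commute algebra_simps)
  have cont: "continuous_on UNIV (\<lambda>x. (2 * a) *\<^sub>R (x - y))" by (intro continuous_intros)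
  show "C1_fun (\<lambda>x. a * ((x - y) \<bullet> (x - y)))" by (rule C1_funI(1)[OF der cont])
  show "grad (\<lambda>x. a * ((x - y) \<bullet> (x - y))) x = (2 * a) *\<^sub>R (x - y)" by (rule grad_eq[OF der])
qed

text \<open>In the variables \<open>x\<close> and \<open>z = y - x\<close> the expression is
  periodic in \<open>x\<close> and the penalty confines \<open>z\<close>, which restores
  compactness.\<close>

lemma doubled_maximum:
  fixes u k :: "real^'n \<Rightarrow> real"
  assumes u: "continuous_on UNIV u" "zn_periodic u" and k: "continuous_on UNIV k" "zn_periodic k"
    and a: "0 < a"
  obtains x0 y0 where "\<And>x y. u x - k y - a * ((x - y) \<bullet> (x - y)) \<le> u x0 - k y0 - a * ((x0 - y0) \<bullet> (x0 - y0))"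
proof -
  obtain B where B: "\<And>x. \<bar>u x\<bar> \<le> B" using periodic_continuous_bounded[OF u] by blast
  obtain C where C: "\<And>x. \<bar>k x\<bar> \<le> C" using periodic_continuous_bounded[OF k] by blast
  define h where "h = (\<lambda>x z. u x - k (x + z) - a * (z \<bullet> z))"
  \<comment> \<open>Beyond this radius \<open>z \<bullet> z \<ge> R\<close>, so the penalty exceeds
    the oscillation of \<open>k\<close> and \<open>z = 0\<close> does better.\<close>
  define R where "R = 2 * (B + C) / a + 1"
  have BC: "0 \<le> B" "0 \<le> C" using B[of 0] C[of 0] by linarith+
  have R: "1 \<le> R" using BC a by (simp add: R_def)
  have hc: "continuous_on (cbox 0 1 \<times> cball 0 R) (\<lambda>z. h (fst z) (snd z))"
    unfolding h_def
    by (intro continuous_intros continuous_on_compose2[OF u(1)] continuous_on_compose2[OF k(1)]) auto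
  moreover have "cbox 0 (1::real^'n) \<times> cball (0::real^'n) R \<noteq> {}"
  proof -
    have "torus_rep 0 \<in> cbox 0 (1::real^'n)" using fund_dom_cbox torus_rep_in by blast
    moreover have "0 \<in> cball (0::real^'n) R" using R by simp
    ultimately show ?thesis by blast
  qed
  ultimately obtain m where m: "\<And>z. z \<in> cbox 0 1 \<times> cball 0 R \<Longrightarrow> h (fst z) (snd z) \<le> h (fst m) (snd m)"
    using continuous_attains_sup[OF compact_Times[OF compact_cbox compact_cball], of 0 "1::real^'n" "0::real^'n" R]
    by blast
  have near: "h x z \<le> h (fst m) (snd m)" if "norm z \<le> R" for x z
  proof -
    have "torus_rep x \<in> cbox 0 1" using fund_dom_cbox torus_rep_in by blast
    then have "h (torus_rep x) z \<le> h (fst m) (snd m)" using m[of "(torus_rep x, z)"] that by simp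
    moreover have "k (torus_rep x + z) = k (x + z)"
      using zn_periodicD[OF k(2) int_vec_torus_rep[of x], of "x + z"] by (simp add: algebra_simps)
    ultimately show ?thesis using zn_periodic_torus_rep[OF u(2), of x] by (simp add: h_def)
  qed
  have all: "h x z \<le> h (fst m) (snd m)" for x z
  proof (cases "norm z \<le> R")
    case False
    have "R * 1 \<le> norm z * norm z" using False R by (intro mult_mono) auto
    then have "R \<le> z \<bullet> z" by (simp add: dot_square_norm power2_eq_square)
    then have "a * R \<le> a * (z \<bullet> z)" using a by (intro mult_left_mono) auto
    moreover have "a * R = 2 * (B + C) + a" using a by (simp add: R_def field_simps)
    moreover have "- k (x + z) \<le> C" "k x \<le> C"
      using C[of "x + z"] C[of x] by linarith+
    ultimately have "2 * (B + C) + a \<le> a * (z \<bullet> z)" "- k (x + z) \<le> C" "k x \<le> C"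
      by simp_all
    then have "- k (x + z) - a * (z \<bullet> z) \<le> - k x" using a BC by argo
    then have "h x z \<le> h x 0" by (simp add: h_def)
    also have "\<dots> \<le> h (fst m) (snd m)" by (rule near) (use R in simp)
    finally show ?thesis .
  qed (rule near)
  have "u x - k y - a * ((x - y) \<bullet> (x - y)) \<le> h (fst m) (snd m)" for x y
    using all[of x "y - x"] by (simp add: h_def inner_diff_left inner_diff_right inner_commute algebra_simps)
  moreover have "h (fst m) (snd m) = u (fst m) - k (fst m + snd m) - a * ((fst m - (fst m + snd m)) \<bullet> (fst m - (fst m + snd m)))"
    by (simp add: h_def)
  ultimately show ?thesis by (intro that[of "fst m" "fst m + snd m"]) simp
qed

context cell_problem
begin

text \<open>A C^1 approximate subsolution is itself a valid test function where \<open>w - u\<close>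
  is maximal, so this half needs no doubling.\<close>

lemma visc_super_le_crit:
  assumes u: "continuous_on UNIV u" "zn_periodic u" "visc_super H P c u"
  shows "c \<le> crit"
proof (rule field_le_epsilon)
  fix \<epsilon> :: real assume "0 < \<epsilon>"
  then obtain w where w: "C1_fun w" "zn_periodic w" "\<And>x. H x (P + grad w x) \<le> crit + \<epsilon>"
    using C1_critical_subsolution by blast
  have "continuous_on UNIV (\<lambda>x. w x - u x)" by (intro continuous_intros u C1_fun_continuous w)
  moreover have "zn_periodic (\<lambda>x. w x - u x)" using u(2) w(2) by (simp add: zn_periodic_def)
  ultimately obtain x0 where "\<And>x. w x - u x \<le> w x0 - u x0" by (rule periodic_attains_sup) blast
  then have "\<And>y. u x0 - w x0 \<le> u y - w y" by (simp add: algebra_simps)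
  then have "c \<le> H x0 (P + grad w x0)"
    using u(3)[unfolded visc_super_def, rule_format, OF conjI[OF w(1) exI[of _ 1]]] by simp
  with w(3)[of x0] show "c \<le> crit + \<epsilon>" by linarith
qed

text \<open>Comparison with \<open>weak_kam\<close> as a supersolution, neither function being
  smooth. Coercivity on the subsolution side bounds the common momentum, so no Lipschitz estimate
  for \<open>u\<close> is required.\<close>

lemma crit_le_visc_sub:
  assumes u: "continuous_on UNIV u" "zn_periodic u" "visc_sub H P c u"
  shows "crit \<le> c"
proof (rule field_le_epsilon)
  fix e :: real assume e: "0 < e"
  obtain M where M: "\<And>x p. norm p \<le> H x p + M" using coercive by blast
  obtain \<delta> where \<delta>: "0 < \<delta>" "\<And>x y p. norm p \<le> c + M \<Longrightarrow> dist x y < \<delta> \<Longrightarrow> \<bar>H x p - H y p\<bar> < e"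
    using periodic_equicontinuous[OF H_continuous periodic e] by blast
  \<comment> \<open>A bound on \<open>q\<close> independent of the penalty; since \<open>q\<close>
    is \<open>2 * a\<close> times \<open>x0 - y0\<close>, the choice of \<open>a\<close> below
    brings the two points within \<open>\<delta>\<close>.\<close>
  define Q where "Q = \<bar>c + M\<bar> + norm P + 1"
  have Q: "0 < Q" by (simp add: Q_def add_nonneg_pos)
  define a where "a = Q / (2 * \<delta>)"
  have a: "0 < a" using Q \<delta> by (simp add: a_def)
  obtain x0 y0 where max: "\<And>x y. u x - weak_kam y - a * ((x - y) \<bullet> (x - y)) \<le> u x0 - weak_kam y0 - a * ((x0 - y0) \<bullet> (x0 - y0))"
    using doubled_maximum[OF u(1,2) dominated_continuous[OF weak_kam_dominated] weak_kam_periodic a] by blast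
  define q where "q = (2 * a) *\<^sub>R (x0 - y0)"
  have sub: "H x0 (P + q) \<le> c"
  proof -
    have "\<forall>y. dist y x0 < 1 \<longrightarrow> u y - a * ((y - y0) \<bullet> (y - y0)) \<le> u x0 - a * ((x0 - y0) \<bullet> (x0 - y0))"
      using max[of _ y0] by (simp add: algebra_simps)
    then have "H x0 (P + grad (\<lambda>x. a * ((x - y0) \<bullet> (x - y0))) x0) \<le> c"
      using u(3)[unfolded visc_sub_def, rule_format, OF conjI[OF C1_fun_quadratic(1) exI[of _ 1]]] by simp
    then show ?thesis by (simp only: C1_fun_quadratic(2) q_def)
  qed
  have super: "crit \<le> H y0 (P + q)"
  proof -
    have "\<forall>y. dist y y0 < 1 \<longrightarrow> weak_kam y - - a * ((y - x0) \<bullet> (y - x0)) \<ge> weak_kam y0 - - a * ((y0 - x0) \<bullet> (y0 - x0))"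
    proof (intro allI impI)
      fix y
      have "(x0 - y) \<bullet> (x0 - y) = (y - x0) \<bullet> (y - x0)" "(x0 - y0) \<bullet> (x0 - y0) = (y0 - x0) \<bullet> (y0 - x0)"
        by (simp_all add: inner_diff_left inner_diff_right inner_commute)
      then show "weak_kam y - - a * ((y - x0) \<bullet> (y - x0)) \<ge> weak_kam y0 - - a * ((y0 - x0) \<bullet> (y0 - x0))"
        using max[of x0 y] by simp
    qed
    then have "crit \<le> H y0 (P + grad (\<lambda>x. - a * ((x - x0) \<bullet> (x - x0))) y0)"
      by (intro weak_kam_visc_super[unfolded visc_super_def, THEN spec, THEN spec, THEN mp]
          conjI exI[of _ 1] zero_less_one C1_fun_quadratic(1))
    moreover have "(2 * - a) *\<^sub>R (y0 - x0) = q" by (simp add: q_def algebra_simps)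
    ultimately show ?thesis by (simp only: C1_fun_quadratic(2))
  qed
  have Pq: "norm (P + q) \<le> c + M" using M[of "P + q" x0] sub by linarith
  have "norm q < Q" using norm_triangle_ineq2[of q "- P"] Pq by (simp add: Q_def add.commute)
  then have "2 * a * norm (x0 - y0) < Q" using a by (simp add: q_def)
  then have "dist x0 y0 < \<delta>" using Q \<delta> by (simp add: a_def dist_norm field_simps)
  from \<delta>(2)[OF Pq this] show "crit \<le> c + e" using sub super by linarith
qed

lemma Hbar_eq_crit: "Hbar H P = crit"
  unfolding Hbar_def
proof (rule the_equality)
  show "\<exists>u. zn_periodic u \<and> visc_sol H P crit u" using weak_kam_periodic weak_kam_visc_sol by blast
  fix c assume "\<exists>u. zn_periodic u \<and> visc_sol H P c u"
  then show "c = crit"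
    unfolding visc_sol_def using visc_super_le_crit crit_le_visc_sub by (blast intro: antisym)
qed

end

subsection \<open>The minimal action\<close>

lemma ereal_integral_eq:
  assumes "integrable M f"
  shows "ereal_integral M f = ereal (integral\<^sup>L M f)"
proof -
  have [simp]: "ennreal (max a 0) = ennreal a" for a
    by (cases "0 \<le> a") (auto simp: ennreal_neg)
  have fin: "(\<integral>\<^sup>+ z. ennreal (f z) \<partial>M) \<noteq> \<infinity>" "(\<integral>\<^sup>+ z. ennreal (- f z) \<partial>M) \<noteq> \<infinity>"
    using assms unfolding real_integrable_def by auto
  have *: "enn2ereal a = ereal (enn2real a)" if "a \<noteq> \<infinity>" for a
    using that by (cases a) (auto simp: enn2ereal_ennreal)
  show ?thesis
    unfolding ereal_integral_def real_lebesgue_integral_def[OF assms]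
    by (simp add: *[OF fin(1)] *[OF fin(2)])
qed

lemma integrable_ereal_integral_le:
  assumes [measurable]: "f \<in> borel_measurable M" and "finite_measure M"
    and lower: "\<And>z. z \<in> space M \<Longrightarrow> - C \<le> f z" and upper: "ereal_integral M f \<le> ereal b"
  shows "integrable M f"
proof -
  interpret finite_measure M by fact
  have [simp]: "ennreal (max a 0) = ennreal a" for a
    by (cases "0 \<le> a") (auto simp: ennreal_neg)
  have "(\<integral>\<^sup>+ z. ennreal (- f z) \<partial>M) \<le> (\<integral>\<^sup>+ z. ennreal C \<partial>M)"
    by (rule nn_integral_mono) (use lower in \<open>force intro!: ennreal_leI\<close>)
  also have "\<dots> < \<infinity>" by (simp add: emeasure_eq_measure ennreal_mult_less_top)
  finally have neg: "(\<integral>\<^sup>+ z. ennreal (- f z) \<partial>M) \<noteq> \<infinity>" by simp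
  have "(\<integral>\<^sup>+ z. ennreal (f z) \<partial>M) \<noteq> \<infinity>"
  proof
    assume "(\<integral>\<^sup>+ z. ennreal (f z) \<partial>M) = \<infinity>"
    moreover obtain r where "(\<integral>\<^sup>+ z. ennreal (- f z) \<partial>M) = ennreal r" "0 \<le> r"
      using neg by (cases "\<integral>\<^sup>+ z. ennreal (- f z) \<partial>M") auto
    ultimately have "ereal_integral M f = \<infinity>"
      by (simp add: ereal_integral_def enn2ereal_ennreal)
    with upper show False by simp
  qed
  with neg show ?thesis unfolding real_integrable_def by simp
qed

lemma has_bochner_integral_le:
  fixes f g :: "'a \<Rightarrow> real"
  assumes "has_bochner_integral M f I" "has_bochner_integral M g J" "\<And>z. f z \<le> g z"
  shows "I \<le> J"
  using assms integral_mono[of M f g] by (simp add: has_bochner_integral_iff)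

lemma grad_periodic:
  assumes "C1_fun \<psi>" "zn_periodic \<psi>"
  shows "zn_periodic (grad \<psi>)"
  unfolding zn_periodic_def
proof (intro allI impI)
  fix x k :: "real^'a" assume k: "int_vec k"
  have "((\<lambda>y. y + k) has_derivative (\<lambda>w. w)) (at x)" by (auto intro!: derivative_eq_intros)
  from has_derivative_compose[OF this C1_funD(1)[OF assms(1)]]
  have "((\<lambda>y. \<psi> (y + k)) has_derivative (\<lambda>w. grad \<psi> (x + k) \<bullet> w)) (at x)" .
  also have "(\<lambda>y. \<psi> (y + k)) = \<psi>" using zn_periodicD[OF assms(2) k] by auto
  finally show "grad \<psi> (x + k) = grad \<psi> x" by (rule grad_eq[symmetric])
qed

text \<open>Half-open intervals tile under concatenation of curves, whereas the fundamental theorem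
  of calculus is applied on closed ones; a single endpoint is null.\<close>

lemma has_bochner_integral_half_open:
  fixes f :: "real \<Rightarrow> real"
  assumes "has_bochner_integral lborel (\<lambda>s. indicator {a..b} s *\<^sub>R f s) I"
  shows "has_bochner_integral lborel (\<lambda>s. indicator {a..<b} s * f s) I"
proof -
  have [measurable]: "(\<lambda>s. indicator {a..b} s *\<^sub>R f s) \<in> borel_measurable lborel"
    using assms by (rule borel_measurable_has_bochner_integral)
  have eq: "(\<lambda>s. indicator {a..<b} s * f s) = (\<lambda>s. indicator {a..<b} s * (indicator {a..b} s *\<^sub>R f s))"
    by (auto simp: indicator_def)
  have "AE s in lborel. s \<noteq> b" by (rule AE_lborel_singleton)
  then have ae: "AE s in lborel. indicator {a..<b} s * (indicator {a..b} s *\<^sub>R f s) = indicator {a..b} s *\<^sub>R f s"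
    by eventually_elim (auto simp: indicator_def)
  show ?thesis unfolding eq
    using assms ae by (subst has_bochner_integral_cong_AE[OF _ _ ae]) measurable
qed

lemma has_bochner_integral_concat:
  fixes f g :: "real \<Rightarrow> real"
  assumes "0 \<le> t" "0 \<le> T"
    and "has_bochner_integral lborel (\<lambda>s. indicator {0..<t} s * f s) I"
    and "has_bochner_integral lborel (\<lambda>s. indicator {0..<T} s * g s) J"
  shows "has_bochner_integral lborel (\<lambda>s. indicator {0..<t + T} s * (if s < t then f s else g (s - t))) (I + J)"
proof -
  have "has_bochner_integral lborel (\<lambda>s. indicator {0..<T} (- t + s) * g (- t + s)) J"
    by (rule lborel_has_bochner_integral_translate[OF assms(4)])
  from has_bochner_integral_add[OF assms(3) this]
  have "has_bochner_integral lborel (\<lambda>s. indicator {0..<t} s * f s + indicator {0..<T} (- t + s) * g (- t + s)) (I + J)" .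
  also have "(\<lambda>s. indicator {0..<t} s * f s + indicator {0..<T} (- t + s) * g (- t + s))
      = (\<lambda>s. indicator {0..<t + T} s * (if s < t then f s else g (s - t)))"
    using assms(1,2) by (auto simp: indicator_def fun_eq_iff)
  finally show ?thesis .
qed

section \<open>Holonomic measures, occupation measures of loops and the infimum of the
  action\<close>

context cell_problem
begin

lemma LP_measurable: "(\<lambda>z. LP (fst z) (snd z)) \<in> borel_measurable borel"
  by (intro borel_measurable_continuous_onI LP_continuous)

lemma action_eq: "action H P \<nu> = ereal_integral \<nu> (\<lambda>z. LP (fst z) (snd z))"
  unfolding action_def LP_def by (simp add: case_prod_unfold)

lemma measurable_torus_prob:
  assumes "torus_prob_measure \<nu>" "f \<in> borel_measurable borel"
  shows "f \<in> borel_measurable \<nu>"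
proof -
  have "sets \<nu> = sets borel" using assms(1) by (simp add: torus_prob_measure_def)
  then show ?thesis using assms(2) by (simp cong: measurable_cong_sets)
qed

lemma integrable_LP:
  assumes "torus_prob_measure \<nu>" "action H P \<nu> \<le> ereal b"
  shows "integrable \<nu> (\<lambda>z. LP (fst z) (snd z))"
proof -
  obtain M where M: "\<And>x v. - M \<le> LP x v" using LP_bounded_below by blast
  interpret prob_space \<nu> using assms(1) by (simp add: torus_prob_measure_def)
  show ?thesis
    by (rule integrable_ereal_integral_le[OF _ finite_measure_axioms])
      (use assms M in \<open>auto simp: action_eq intro: measurable_torus_prob LP_measurable\<close>)
qed

lemma holonomicD:
  assumes "\<nu> \<in> holonomic" "C1_fun \<psi>" "zn_periodic \<psi>"
  shows "has_bochner_integral \<nu> (\<lambda>z. snd z \<bullet> grad \<psi> (fst z)) 0"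
  using assms by (simp add: holonomic_def case_prod_unfold)

lemma action_ge_crit:
  assumes "\<nu> \<in> holonomic"
  shows "ereal (- crit) \<le> action H P \<nu>"
proof (rule ccontr)
  assume neg: "\<not> ?thesis"
  have tp: "torus_prob_measure \<nu>" using assms by (simp add: holonomic_def)
  interpret prob_space \<nu> using tp by (simp add: torus_prob_measure_def)
  \<comment> \<open>The contradiction hypothesis bounds the action above and so excludes the value
    infinity; only then may the vanishing holonomy term be added under the integral.\<close>
  have int: "integrable \<nu> (\<lambda>z. LP (fst z) (snd z))"
    by (rule integrable_LP[OF tp, of "- crit"]) (use neg in simp)
  let ?I = "integral\<^sup>L \<nu> (\<lambda>z. LP (fst z) (snd z))"
  have "- crit \<le> ?I"
  proof (rule field_le_epsilon)
    fix \<epsilon> :: real assume "0 < \<epsilon>"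
    then obtain w where w: "C1_fun w" "zn_periodic w" "\<And>x. H x (P + grad w x) \<le> crit + \<epsilon>"
      using C1_critical_subsolution by blast
    note hol = holonomicD[OF assms w(1,2)]
    have "- (crit + \<epsilon>) = integral\<^sup>L \<nu> (\<lambda>z. - (crit + \<epsilon>))" by (simp add: prob_space)
    also have "\<dots> \<le> integral\<^sup>L \<nu> (\<lambda>z. LP (fst z) (snd z) + snd z \<bullet> grad w (fst z))"
    proof (rule integral_mono)
      show "integrable \<nu> (\<lambda>z. LP (fst z) (snd z) + snd z \<bullet> grad w (fst z))"
        using int hol by (auto simp: has_bochner_integral_iff)
      fix z :: "(real^'n) \<times> (real^'n)"
      show "- (crit + \<epsilon>) \<le> LP (fst z) (snd z) + snd z \<bullet> grad w (fst z)"
        using LP_Fenchel[of "grad w (fst z)" "snd z" "fst z"] w(3)[of "fst z"] by (simp add: inner_commute)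
    qed simp
    also have "\<dots> = ?I" using int hol by (simp add: has_bochner_integral_iff)
    finally show "- crit \<le> ?I + \<epsilon>" by simp
  qed
  then show False using neg by (simp add: action_eq ereal_integral_eq[OF int])
qed

text \<open>The integral identity for all C^1 functions encodes that \<open>\<beta>\<close> is the
  velocity of \<open>\<gamma>\<close> and telescopes over segments, so the corners need no separate
  treatment.\<close>

lemma reach_parametrization:
  assumes "reach x y T A"
  shows "\<exists>\<gamma> \<beta>. \<gamma> \<in> borel_measurable borel \<and> \<beta> \<in> borel_measurable borel \<and>
    (\<forall>\<psi>. C1_fun \<psi> \<longrightarrow> has_bochner_integral lborel (\<lambda>s. indicator {0..<T} s * (\<beta> s \<bullet> grad \<psi> (\<gamma> s))) (\<psi> y - \<psi> x)) \<and>
    (\<exists>I\<le>A. has_bochner_integral lborel (\<lambda>s. indicator {0..<T} s * LP (\<gamma> s) (\<beta> s)) I)"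
  using assms
proof (induction rule: reach.induct)
  case (stay x)
  show ?case
    by (intro exI[of _ "\<lambda>_. 0"] conjI exI[of _ "0::real"]) (auto intro: has_bochner_integral_zero)
next
  case (step t x v K y T A)
  then obtain \<gamma> \<beta> I where [measurable]: "\<gamma> \<in> borel_measurable borel" "\<beta> \<in> borel_measurable borel"
    and hol: "\<And>\<psi>. C1_fun \<psi> \<Longrightarrow> has_bochner_integral lborel (\<lambda>s. indicator {0..<T} s * (\<beta> s \<bullet> grad \<psi> (\<gamma> s))) (\<psi> y - \<psi> (x + t *\<^sub>R v))"
    and I: "I \<le> A" "has_bochner_integral lborel (\<lambda>s. indicator {0..<T} s * LP (\<gamma> s) (\<beta> s)) I"
    by blast
  have T: "0 \<le> T" by (rule reach_nonneg[OF step(3)])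
  define \<gamma>' where "\<gamma>' = (\<lambda>s. if s < t then x + s *\<^sub>R v else \<gamma> (s - t))"
  define \<beta>' where "\<beta>' = (\<lambda>s. if s < t then v else \<beta> (s - t))"
  have meas: "\<gamma>' \<in> borel_measurable borel" "\<beta>' \<in> borel_measurable borel"
    unfolding \<gamma>'_def \<beta>'_def by measurable
  have hol': "has_bochner_integral lborel (\<lambda>s. indicator {0..<t + T} s * (\<beta>' s \<bullet> grad \<psi> (\<gamma>' s))) (\<psi> y - \<psi> x)"
    if \<psi>: "C1_fun \<psi>" for \<psi>
  proof -
    have "has_bochner_integral lborel (\<lambda>s. indicator {0..t} s *\<^sub>R (v \<bullet> grad \<psi> (x + s *\<^sub>R v)))
        (\<psi> (x + t *\<^sub>R v) - \<psi> (x + 0 *\<^sub>R v))"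
    proof (rule has_bochner_integral_FTC_Icc[OF step(1)])
      show "((\<lambda>s. \<psi> (x + s *\<^sub>R v)) has_vector_derivative v \<bullet> grad \<psi> (x + s *\<^sub>R v)) (at s within {0..t})" for s
        using C1_fun_segment[OF \<psi>, of x v s] by (simp add: has_real_derivative_iff_has_vector_derivative inner_commute)
      show "continuous_on {0..t} (\<lambda>s. v \<bullet> grad \<psi> (x + s *\<^sub>R v))"
        by (intro continuous_intros continuous_on_compose2[OF C1_funD(2)[OF \<psi>]]) auto
    qed
    from has_bochner_integral_concat[OF step(1) T has_bochner_integral_half_open[OF this] hol[OF \<psi>]]
    have "has_bochner_integral lborel (\<lambda>s. indicator {0..<t + T} s * (if s < t then v \<bullet> grad \<psi> (x + s *\<^sub>R v)
        else \<beta> (s - t) \<bullet> grad \<psi> (\<gamma> (s - t)))) (\<psi> y - \<psi> x)" by simp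
    also have "(\<lambda>s. if s < t then v \<bullet> grad \<psi> (x + s *\<^sub>R v) else \<beta> (s - t) \<bullet> grad \<psi> (\<gamma> (s - t)))
        = (\<lambda>s. \<beta>' s \<bullet> grad \<psi> (\<gamma>' s))"
      by (auto simp: \<gamma>'_def \<beta>'_def)
    finally show ?thesis by (simp add: fun_eq_iff \<gamma>'_def \<beta>'_def if_distrib)
  qed
  have LPc: "continuous_on {0..t} (\<lambda>s. LP (x + s *\<^sub>R v) v)"
    unfolding LP_def by (intro continuous_intros)
  then obtain J where J: "has_bochner_integral lborel (\<lambda>s. indicator {0..t} s *\<^sub>R LP (x + s *\<^sub>R v) v) J"
    using borel_integrable_compact[OF compact_Icc LPc] has_bochner_integral_integrable by blast
  have Kint: "has_bochner_integral lborel (\<lambda>s. indicator {0..t} s *\<^sub>R K) (t * K)"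
    using has_bochner_integral_scaleR_left[OF has_bochner_integral_real_indicator[of "{0..t}" lborel], of K] step(1) by simp
  have "J \<le> t * K"
    by (rule has_bochner_integral_le[OF J Kint]) (auto simp: indicator_def intro: step(2))
  from has_bochner_integral_concat[OF step(1) T has_bochner_integral_half_open[OF J] I(2)]
  have "has_bochner_integral lborel (\<lambda>s. indicator {0..<t + T} s * LP (\<gamma>' s) (\<beta>' s)) (J + I)"
    unfolding \<gamma>'_def \<beta>'_def by (rule has_bochner_integral_cong[THEN iffD1, rotated -1]) auto
  then show ?case using hol' meas \<open>J \<le> t * K\<close> I(1)
    by (intro exI[of _ \<gamma>'] exI[of _ \<beta>'] conjI exI[of _ "J + I"]) auto
qed

text \<open>The normalized occupation measure of the loop, folded into the fundamental domain.
  Holonomy holds because a periodic function takes equal values at both ends.\<close>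

lemma loop_measure:
  assumes "int_vec k" "reach x (x + k) T A" "0 < T"
  obtains \<nu> where "\<nu> \<in> holonomic" "action H P \<nu> \<le> ereal (A / T)"
proof -
  obtain \<gamma> \<beta> I where [measurable]: "\<gamma> \<in> borel_measurable borel" "\<beta> \<in> borel_measurable borel"
    and hol: "\<And>\<psi>. C1_fun \<psi> \<Longrightarrow> has_bochner_integral lborel (\<lambda>s. indicator {0..<T} s * (\<beta> s \<bullet> grad \<psi> (\<gamma> s))) (\<psi> (x + k) - \<psi> x)"
    and I: "I \<le> A" "has_bochner_integral lborel (\<lambda>s. indicator {0..<T} s * LP (\<gamma> s) (\<beta> s)) I"
    using reach_parametrization[OF assms(2)] by blast
  define N where "N = density lborel (\<lambda>s. ennreal (indicator {0..<T} s / T))"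
  define g where "g = (\<lambda>s. (torus_rep (\<gamma> s), \<beta> s))"
  have [measurable]: "g \<in> borel_measurable borel" unfolding g_def by measurable
  have gN: "g \<in> measurable N borel" unfolding N_def by measurable
  define \<nu> where "\<nu> = distr N borel g"
  have "emeasure N (space N) = (\<integral>\<^sup>+ s. ennreal (1 / T) * indicator {0..<T} s \<partial>lborel)"
    unfolding N_def by (subst emeasure_density) (auto intro!: nn_integral_cong simp: indicator_def)
  also have "\<dots> = ennreal (1 / T) * ennreal T"
    using assms(3) by (subst nn_integral_cmult_indicator) auto
  also have "\<dots> = 1" using assms(3) by (simp add: ennreal_mult[symmetric])
  finally have "prob_space N" by (rule prob_spaceI)
  then interpret N: prob_space N .
  have "prob_space \<nu>" unfolding \<nu>_def by (rule N.prob_space_distr[OF gN])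
  moreover have "emeasure \<nu> (- (fund_dom \<times> UNIV)) = 0"
  proof -
    have "fund_dom \<times> UNIV \<in> sets (borel :: ((real^'n) \<times> (real^'n)) measure)"
      unfolding borel_prod[symmetric] by (intro pair_measureI) auto
    then have "- (fund_dom \<times> UNIV) \<in> sets (borel :: ((real^'n) \<times> (real^'n)) measure)"
      by (rule borel_comp)
    moreover have "g -` (- (fund_dom \<times> UNIV)) \<inter> space N = {}" by (auto simp: g_def torus_rep_in)
    ultimately show ?thesis unfolding \<nu>_def by (simp add: emeasure_distr[OF gN])
  qed
  ultimately have tp: "torus_prob_measure \<nu>" by (simp add: torus_prob_measure_def \<nu>_def)
  \<comment> \<open>Periodic integrands do not see the folding by \<open>torus_rep\<close>, so
    integrals against \<open>\<nu>\<close> are time averages along the unfolded curve.\<close>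
  have transfer: "has_bochner_integral \<nu> (\<lambda>z. f (fst z) (snd z)) (J / T)"
    if "(\<lambda>z. f (fst z) (snd z)) \<in> borel_measurable borel" "\<And>v. zn_periodic (\<lambda>x. f x v)"
      "has_bochner_integral lborel (\<lambda>s. indicator {0..<T} s * f (\<gamma> s) (\<beta> s)) J" for f :: "_ \<Rightarrow> _ \<Rightarrow> real" and J
    unfolding \<nu>_def
  proof (rule has_bochner_integral_distr[OF that(1) gN])
    have fg: "(\<lambda>s. f (fst (g s)) (snd (g s))) = (\<lambda>s. f (\<gamma> s) (\<beta> s))"
      using zn_periodic_torus_rep[OF that(2)] by (simp add: g_def)
    have [measurable]: "(\<lambda>s. f (fst (g s)) (snd (g s))) \<in> borel_measurable borel"
      using measurable_compose[OF \<open>g \<in> borel_measurable borel\<close> that(1)] by simp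
    show "has_bochner_integral N (\<lambda>s. f (fst (g s)) (snd (g s))) (J / T)"
      unfolding N_def
    proof (rule has_bochner_integral_density)
      show "has_bochner_integral lborel (\<lambda>s. (indicator {0..<T} s / T) *\<^sub>R f (fst (g s)) (snd (g s))) (J / T)"
        using has_bochner_integral_divide_zero[OF that(3), of T] fg by (simp add: fun_eq_iff)
    qed (use assms(3) in \<open>auto\<close>)
  qed
  have "has_bochner_integral \<nu> (\<lambda>z. snd z \<bullet> grad \<psi> (fst z)) 0" if \<psi>: "C1_fun \<psi>" "zn_periodic \<psi>" for \<psi>
  proof -
    have "has_bochner_integral \<nu> (\<lambda>z. snd z \<bullet> grad \<psi> (fst z)) ((\<psi> (x + k) - \<psi> x) / T)"
    proof (rule transfer[OF _ _ hol[OF \<psi>(1)]])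
      show "(\<lambda>z. snd z \<bullet> grad \<psi> (fst z)) \<in> borel_measurable borel"
        by (intro borel_measurable_continuous_onI continuous_intros continuous_on_compose2[OF C1_funD(2)[OF \<psi>(1)]]) auto
      show "zn_periodic (\<lambda>x. v \<bullet> grad \<psi> x)" for v
        using grad_periodic[OF \<psi>] by (simp add: zn_periodic_def)
    qed
    then show ?thesis using zn_periodicD[OF \<psi>(2) assms(1)] by simp
  qed
  then have "\<nu> \<in> holonomic" using tp by (simp add: holonomic_def case_prod_unfold)
  moreover have "has_bochner_integral \<nu> (\<lambda>z. LP (fst z) (snd z)) (I / T)"
    by (rule transfer[OF LP_measurable LP_periodic I(2)])
  then have "action H P \<nu> = ereal (I / T)"
    unfolding action_eq by (simp add: has_bochner_integral_iff ereal_integral_eq)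
  then have "action H P \<nu> \<le> ereal (A / T)" using I(1) assms(3) by (simp add: divide_right_mono)
  ultimately show ?thesis by (rule that)
qed

lemma near_minimizer:
  assumes "0 < \<epsilon>"
  obtains \<nu> where "\<nu> \<in> holonomic" "action H P \<nu> \<le> ereal (- crit + \<epsilon>)"
proof -
  obtain x k T A where *: "int_vec k" "reach x (x + k) T A" "0 < T" "A + (crit - \<epsilon>) * T < 0"
    by (rule subcritical_loop[of "crit - \<epsilon>"]) (use assms in auto)
  have "A / T \<le> - crit + \<epsilon>" using *(3,4) by (simp add: field_simps)
  then have "ereal (A / T) \<le> ereal (- crit + \<epsilon>)" by simp
  moreover obtain \<nu> where "\<nu> \<in> holonomic" "action H P \<nu> \<le> ereal (A / T)"
    by (rule loop_measure[OF *(1-3)])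
  ultimately show ?thesis using that order_trans by blast
qed

text \<open>Comparison with the near minimizers bounds the action from above for every
  \<open>\<epsilon>\<close>; this also gives integrability, so the extended-real action becomes an
  ordinary integral.\<close>

lemma minimizer_iff:
  "is_minimizer H P \<nu> \<longleftrightarrow> \<nu> \<in> holonomic \<and> has_bochner_integral \<nu> (\<lambda>z. LP (fst z) (snd z)) (- crit)"
proof
  assume min: "is_minimizer H P \<nu>"
  then have hol: "\<nu> \<in> holonomic" by (simp add: is_minimizer_def)
  have "action H P \<nu> \<le> ereal (- crit)"
  proof (rule ereal_le_epsilon2)
    fix \<epsilon> :: real assume "0 < \<epsilon>"
    then obtain \<nu>' where "\<nu>' \<in> holonomic" "action H P \<nu>' \<le> ereal (- crit + \<epsilon>)"
      using near_minimizer by blast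
    with min have "action H P \<nu> \<le> ereal (- crit + \<epsilon>)"
      unfolding is_minimizer_def by (meson order_trans)
    then show "action H P \<nu> \<le> ereal (- crit) + ereal \<epsilon>" by simp
  qed
  moreover from this have int: "integrable \<nu> (\<lambda>z. LP (fst z) (snd z))"
    using hol by (intro integrable_LP) (auto simp: holonomic_def)
  ultimately show "\<nu> \<in> holonomic \<and> has_bochner_integral \<nu> (\<lambda>z. LP (fst z) (snd z)) (- crit)"
    using hol action_ge_crit[OF hol] by (simp add: has_bochner_integral_iff action_eq ereal_integral_eq)
next
  assume *: "\<nu> \<in> holonomic \<and> has_bochner_integral \<nu> (\<lambda>z. LP (fst z) (snd z)) (- crit)"
  then have "action H P \<nu> = ereal (- crit)"
    by (simp add: has_bochner_integral_iff action_eq ereal_integral_eq)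
  then show "is_minimizer H P \<nu>"
    using * action_ge_crit by (auto simp: is_minimizer_def)
qed

end

subsection \<open>Energy of minimizers\<close>

text \<open>On the compact set left after removing a ball around \<open>p\<close>, \<open>g\<close>
  has a positive minimum, which \<open>g (q n)\<close> eventually undercuts.\<close>

lemma converges_to_unique_zero:
  fixes g :: "'a::euclidean_space \<Rightarrow> real"
  assumes g: "continuous_on UNIV g" "\<And>q. 0 \<le> g q" "\<And>q. g q = 0 \<longleftrightarrow> q = p"
    and q: "\<And>n. norm (q n) \<le> R" "(\<lambda>n. g (q n)) \<longlonglongrightarrow> 0"
  shows "q \<longlonglongrightarrow> p"
proof (rule tendstoI)
  fix e :: real assume "0 < e"
  define K where "K = cball 0 R - ball p e"
  have K: "compact K" unfolding K_def by (intro compact_diff) auto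
  show "\<forall>\<^sub>F n in sequentially. dist (q n) p < e"
  proof (cases "K = {}")
    case True
    have "dist (q n) p < e" for n using q(1)[of n] True by (auto simp: K_def dist_commute)
    then show ?thesis by simp
  next
    case False
    obtain m where m: "m \<in> K" "\<And>q. q \<in> K \<Longrightarrow> g m \<le> g q"
      using continuous_attains_inf[OF K False continuous_on_subset[OF g(1)]] by auto
    have "m \<noteq> p" using m(1) \<open>0 < e\<close> by (auto simp: K_def)
    then have "0 < g m" using g(2)[of m] g(3)[of m] by linarith
    then have "\<forall>\<^sub>F n in sequentially. g (q n) < g m" by (rule order_tendstoD(2)[OF q(2)])
    then show ?thesis
    proof eventually_elim
      case (elim n)
      then have "q n \<notin> K" using m(2) by force
      then show ?case using q(1)[of n] by (auto simp: K_def dist_commute)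
    qed
  qed
qed

context cell_problem
begin

text \<open>The optimal momentum is the limit of \<open>P + grad w\<close> along smooth approximate subsolutions \<open>w\<close>:
  the Fenchel gap of \<open>P + grad w\<close> tends to zero in mean, and the Fenchel gap has a unique zero.\<close>

lemma minimizer_energy:
  assumes hol: "\<nu> \<in> holonomic" and min: "has_bochner_integral \<nu> (\<lambda>z. LP (fst z) (snd z)) (- crit)"
  shows "has_bochner_integral \<nu> (\<lambda>z. H (fst z) (mom (fst z) (snd z))) crit"
    and "AE z in \<nu>. H (fst z) (mom (fst z) (snd z)) = crit"
proof -
  have tp: "torus_prob_measure \<nu>" using hol by (simp add: holonomic_def)
  interpret prob_space \<nu> using tp by (simp add: torus_prob_measure_def)
  let ?\<epsilon> = "\<lambda>n. inverse (real (Suc n))"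
  have "\<exists>w. C1_fun w \<and> zn_periodic w \<and> (\<forall>x. H x (P + grad w x) \<le> crit + ?\<epsilon> n)" for n
    using C1_critical_subsolution[of "?\<epsilon> n"] by auto
  then obtain w where w: "\<And>n. C1_fun (w n)" "\<And>n. zn_periodic (w n)"
      "\<And>n x. H x (P + grad (w n) x) \<le> crit + ?\<epsilon> n" by metis
  obtain M where M: "\<And>x p. norm p \<le> H x p + M" using coercive by blast
  \<comment> \<open>The 1 bounds every \<open>?\<epsilon> n\<close>. A radius uniform in
    \<open>n\<close> supplies both the dominating constant and the compactness for the limit of
    momenta.\<close>
  define R where "R = crit + 1 + M"
  have R: "norm (P + grad (w n) x) \<le> R" for n x
    using M[of "P + grad (w n) x" x] w(3)[of x n] inverse_le_1_iff[of "real (Suc n)"] by (simp add: R_def)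
  obtain C where C: "\<And>x p. norm p \<le> R \<Longrightarrow> \<bar>H x p\<bar> \<le> C"
    using periodic_bounded[OF H_continuous periodic] by blast
  define h where "h = (\<lambda>n (z :: (real^'n) \<times> (real^'n)). H (fst z) (P + grad (w n) (fst z)))"
  \<comment> \<open>The Fenchel gap of \<open>P + grad (w n)\<close>. Holonomy removes the middle
    term from its integral, which is thus the mean of \<open>h n\<close> minus
    \<open>crit\<close>.\<close>
  define e where "e = (\<lambda>n z. LP (fst z) (snd z) + snd z \<bullet> grad (w n) (fst z) + h n z)"
  have h_meas: "h n \<in> borel_measurable \<nu>" for n
    unfolding h_def
    by (intro measurable_torus_prob[OF tp] borel_measurable_continuous_onI continuous_intros
        continuous_on_compose2[OF C1_funD(2)[OF w(1)]]) auto
  have h_bound: "\<bar>h n z\<bar> \<le> C" for n z unfolding h_def by (intro C R)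
  have h_int: "integrable \<nu> (h n)" for n
    by (rule integrable_const_bound[of _ C]) (auto simp: h_bound h_meas)
  have e_nonneg: "0 \<le> e n z" for n z
    using LP_Fenchel[of "grad (w n) (fst z)" "snd z" "fst z"] by (simp add: e_def h_def inner_commute)
  have e_int: "has_bochner_integral \<nu> (e n) (- crit + 0 + integral\<^sup>L \<nu> (h n))" for n
    unfolding e_def
    by (intro has_bochner_integral_add min holonomicD[OF hol] w has_bochner_integral_integrable h_int)
  have h_le: "integral\<^sup>L \<nu> (h n) \<le> crit + ?\<epsilon> n" for n
  proof -
    have "integral\<^sup>L \<nu> (h n) \<le> integral\<^sup>L \<nu> (\<lambda>z. crit + ?\<epsilon> n)"
      by (rule integral_mono[OF h_int]) (auto simp: h_def w(3) simp del: of_nat_Suc)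
    then show ?thesis by (simp add: prob_space)
  qed
  have lim: "(\<lambda>n. integral\<^sup>L \<nu> (\<lambda>z. norm (e n z))) \<longlonglongrightarrow> 0"
  proof (rule tendsto_sandwich[OF _ _ tendsto_const LIMSEQ_inverse_real_of_nat])
    show "\<forall>\<^sub>F n in sequentially. 0 \<le> integral\<^sup>L \<nu> (\<lambda>z. norm (e n z))" by simp
    show "\<forall>\<^sub>F n in sequentially. integral\<^sup>L \<nu> (\<lambda>z. norm (e n z)) \<le> ?\<epsilon> n"
    proof (rule always_eventually, rule allI)
      fix n
      have "integral\<^sup>L \<nu> (\<lambda>z. norm (e n z)) = - crit + 0 + integral\<^sup>L \<nu> (h n)"
        using has_bochner_integral_integral_eq[OF e_int[of n]] e_nonneg by simp
      then show "integral\<^sup>L \<nu> (\<lambda>z. norm (e n z)) \<le> ?\<epsilon> n" using h_le[of n] by linarith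
    qed
  qed
  have "integrable \<nu> (e n)" for n using e_int by (simp add: has_bochner_integral_iff)
  \<comment> \<open>Convergence in mean gives pointwise convergence only along a subsequence, which
    is enough to identify the limit.\<close>
  from tendsto_L1_AE_subseq[OF this lim] obtain r where r: "strict_mono r"
      and ae: "AE z in \<nu>. (\<lambda>n. e (r n) z) \<longlonglongrightarrow> 0" by blast
  have conv: "(\<lambda>n. h (r n) z) \<longlonglongrightarrow> H (fst z) (mom (fst z) (snd z))"
    if z: "(\<lambda>n. e (r n) z) \<longlonglongrightarrow> 0" for z
  proof -
    define x where "x = fst z"
    define v where "v = snd z"
    let ?g = "\<lambda>q. Lagr H x v + q \<bullet> v + H x q"
    have q: "(\<lambda>n. P + grad (w (r n)) x) \<longlonglongrightarrow> mom x v"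
    proof (rule converges_to_unique_zero[of ?g _ _ R])
      show "continuous_on UNIV ?g" by (intro continuous_intros)
      show "0 \<le> ?g q" for q using Fenchel[of q v x] by simp
      show "?g q = 0 \<longleftrightarrow> q = mom x v" for q using Fenchel_eq_iff[of x v q] by auto
      show "norm (P + grad (w (r n)) x) \<le> R" for n by (rule R)
      show "(\<lambda>n. ?g (P + grad (w (r n)) x)) \<longlonglongrightarrow> 0"
        using z by (simp add: e_def h_def LP_def x_def v_def inner_add_left inner_commute algebra_simps)
    qed
    have "continuous_on UNIV (\<lambda>q. H x q)" by (intro continuous_intros)
    from continuous_on_tendsto_compose[OF this q] show ?thesis
      by (simp add: h_def x_def v_def)
  qed
  let ?E = "\<lambda>z. H (fst z) (mom (fst z) (snd z))"
  have E_meas: "?E \<in> borel_measurable \<nu>"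
    by (intro measurable_torus_prob[OF tp] borel_measurable_continuous_onI continuous_intros mom_continuous)
  have h_conv: "AE z in \<nu>. (\<lambda>n. h (r n) z) \<longlonglongrightarrow> ?E z" using ae by eventually_elim (rule conv)
  have const_int: "integrable \<nu> (\<lambda>z. C)" by simp
  note dct = E_meas h_meas const_int h_conv
  have bound: "AE z in \<nu>. norm (h (r n) z) \<le> C" for n by (simp add: h_bound)
  have E_int: "integrable \<nu> ?E"
    by (rule integrable_dominated_convergence[OF dct bound])
  have h_lim1: "(\<lambda>n. integral\<^sup>L \<nu> (h (r n))) \<longlonglongrightarrow> integral\<^sup>L \<nu> ?E"
    by (rule integral_dominated_convergence[OF dct bound])
  have "(\<lambda>n. integral\<^sup>L \<nu> (\<lambda>z. norm (e (r n) z)) + crit) \<longlonglongrightarrow> 0 + crit"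
    using LIMSEQ_subseq_LIMSEQ[OF lim r] by (intro tendsto_intros) (simp add: o_def)
  moreover have "integral\<^sup>L \<nu> (\<lambda>z. norm (e n z)) + crit = integral\<^sup>L \<nu> (h n)" for n
    using has_bochner_integral_integral_eq[OF e_int[of n]] e_nonneg by simp
  ultimately have "(\<lambda>n. integral\<^sup>L \<nu> (h (r n))) \<longlonglongrightarrow> crit" by simp
  with h_lim1 have E_eq: "integral\<^sup>L \<nu> ?E = crit" by (rule LIMSEQ_unique)
  with E_int show *: "has_bochner_integral \<nu> ?E crit" by (simp add: has_bochner_integral_iff)
  \<comment> \<open>The subsolution bound passes to the pointwise limit; an upper bound whose gap
    has integral zero is attained almost everywhere.\<close>
  have E_le: "AE z in \<nu>. 0 \<le> crit - ?E z"
    using h_conv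
  proof eventually_elim
    case (elim z)
    have "(\<lambda>n. crit + ?\<epsilon> (r n)) \<longlonglongrightarrow> crit + 0"
      using LIMSEQ_subseq_LIMSEQ[OF LIMSEQ_inverse_real_of_nat r]
      by (intro tendsto_intros) (simp add: o_def)
    from LIMSEQ_le[OF elim this] have "?E z \<le> crit"
      using w(3) by (simp add: h_def del: of_nat_Suc)
    then show ?case by simp
  qed
  have "integrable \<nu> (\<lambda>z. crit - ?E z)" using E_int by simp
  moreover have "integral\<^sup>L \<nu> (\<lambda>z. crit - ?E z) = 0" using E_int E_eq by (simp add: prob_space)
  ultimately have "AE z in \<nu>. crit - ?E z = 0"
    using integral_nonneg_eq_0_iff_AE[OF _ E_le] by blast
  then show "AE z in \<nu>. ?E z = crit" by eventually_elim simp
qed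

section \<open>Transfer to momentum variables and the characterization\<close>

lemma has_bochner_integral_Phi:
  fixes f :: "real^'n \<Rightarrow> real^'n \<Rightarrow> real"
  assumes "torus_prob_measure \<nu>" "(\<lambda>z. f (fst z) (snd z)) \<in> borel_measurable borel"
  shows "has_bochner_integral (distr \<nu> borel (Phi H)) (\<lambda>(x, p). f x p) I \<longleftrightarrow>
    has_bochner_integral \<nu> (\<lambda>z. f (fst z) (mom (fst z) (snd z))) I"
proof -
  have "Phi H \<in> measurable \<nu> borel" by (rule measurable_torus_prob[OF assms(1) Phi_measurable])
  then show ?thesis using assms(2)
    by (simp add: has_bochner_integral_iff integrable_distr_eq integral_distr case_prod_unfold)
      (simp add: Phi_eq)
qed

lemma minimizer_characterization:
  assumes nu: "torus_prob_measure \<nu>"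
  shows "is_minimizer H P \<nu> \<longleftrightarrow>
    (let \<mu> = distr \<nu> borel (Phi H) in
       has_bochner_integral \<mu> (\<lambda>(x, p). H x p) (Hbar H P) \<and>
       (AE (x, p) in \<mu>. H x p = Hbar H P) \<and>
       has_bochner_integral \<mu> (\<lambda>(x, p). (p - P) \<bullet> grad (H x) p) 0 \<and>
       (\<forall>\<phi>::real^'n \<Rightarrow> real. C1_fun \<phi> \<and> zn_periodic \<phi> \<longrightarrow>
          has_bochner_integral \<mu> (\<lambda>(x, p). grad (H x) p \<bullet> grad \<phi> x) 0))"
proof -
  let ?\<mu> = "distr \<nu> borel (Phi H)"
  have H_meas: "(\<lambda>z. H (fst z) (snd z)) \<in> borel_measurable borel"
    by (intro borel_measurable_continuous_onI H_continuous)
  note energy = has_bochner_integral_Phi[OF nu H_meas, of crit]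
  have ae: "(AE (x, p) in ?\<mu>. H x p = crit) \<longleftrightarrow> (AE z in \<nu>. H (fst z) (mom (fst z) (snd z)) = crit)"
  proof -
    have "Phi H \<in> measurable \<nu> borel" by (rule measurable_torus_prob[OF nu Phi_measurable])
    moreover have "{z. H (fst z) (snd z) = crit} \<in> sets borel" using H_meas by measurable
    ultimately show ?thesis
      by (simp add: AE_distr_iff case_prod_unfold) (simp add: Phi_eq)
  qed
  have "(\<lambda>z. (snd z - P) \<bullet> DH (fst z) (snd z)) \<in> borel_measurable borel"
    by (intro borel_measurable_continuous_onI continuous_intros DH_continuous)
  note virial = has_bochner_integral_Phi[OF nu this, of 0]
  \<comment> \<open>Since \<open>DH x (mom x v) = - v\<close>, condition (c) is holonomy with the
    opposite sign, harmless because the integral is zero.\<close>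
  have rot: "has_bochner_integral ?\<mu> (\<lambda>(x, p). DH x p \<bullet> grad \<phi> x) 0 \<longleftrightarrow>
      has_bochner_integral \<nu> (\<lambda>z. snd z \<bullet> grad \<phi> (fst z)) 0" if "C1_fun \<phi>" for \<phi>
  proof -
    have "(\<lambda>z. DH (fst z) (snd z) \<bullet> grad \<phi> (fst z)) \<in> borel_measurable borel"
      by (intro borel_measurable_continuous_onI continuous_intros DH_continuous
          continuous_on_compose2[OF C1_funD(2)[OF that]]) auto
    from has_bochner_integral_Phi[OF nu this, of 0] show ?thesis
      using has_bochner_integral_minus[of \<nu> "\<lambda>z. snd z \<bullet> grad \<phi> (fst z)" 0]
        has_bochner_integral_minus[of \<nu> "\<lambda>z. - (snd z \<bullet> grad \<phi> (fst z))" 0]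
      by (auto simp: DH_mom)
  qed
  have hol: "\<nu> \<in> holonomic \<longleftrightarrow> (\<forall>\<phi>. C1_fun \<phi> \<and> zn_periodic \<phi> \<longrightarrow>
      has_bochner_integral ?\<mu> (\<lambda>(x, p). DH x p \<bullet> grad \<phi> x) 0)"
    using nu rot by (auto simp: holonomic_def case_prod_unfold)
  \<comment> \<open>Fenchel's equality at the optimal momentum, shifted by \<open>P\<close>: the
    virial integrand in (b) is the sum of Lagrangian and energy, so once the mean energy is
    \<open>crit\<close>, (b) says exactly that the action is \<open>- crit\<close>.\<close>
  have LP_eq: "LP (fst z) (snd z) + H (fst z) (mom (fst z) (snd z)) =
      (mom (fst z) (snd z) - P) \<bullet> DH (fst z) (mom (fst z) (snd z))" for z
    by (simp add: LP_def Lagr_eq DH_mom inner_diff_left)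
  show ?thesis
    unfolding Let_def grad_H Hbar_eq_crit minimizer_iff energy ae virial hol[symmetric]
  proof safe
    assume *: "\<nu> \<in> holonomic" "has_bochner_integral \<nu> (\<lambda>z. LP (fst z) (snd z)) (- crit)"
    show E: "has_bochner_integral \<nu> (\<lambda>z. H (fst z) (mom (fst z) (snd z))) crit"
      and "AE z in \<nu>. H (fst z) (mom (fst z) (snd z)) = crit"
      by (rule minimizer_energy[OF *])+
    from has_bochner_integral_add[OF *(2) E]
    show "has_bochner_integral \<nu> (\<lambda>z. (mom (fst z) (snd z) - P) \<bullet> DH (fst z) (mom (fst z) (snd z))) 0"
      by (simp add: LP_eq)
  next
    assume "has_bochner_integral \<nu> (\<lambda>z. (mom (fst z) (snd z) - P) \<bullet> DH (fst z) (mom (fst z) (snd z))) 0"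
      and "has_bochner_integral \<nu> (\<lambda>z. H (fst z) (mom (fst z) (snd z))) crit"
    from has_bochner_integral_diff[OF this]
    show "has_bochner_integral \<nu> (\<lambda>z. LP (fst z) (snd z)) (- crit)"
      by (simp add: LP_eq[symmetric])
  qed
qed

end

theorem theorem1p3:
  fixes H :: "real^'n \<Rightarrow> real^'n \<Rightarrow> real" and P :: "real^'n"
    and \<nu> :: "((real^'n) \<times> (real^'n)) measure"
  assumes smooth: "smooth_fun (\<lambda>z::(real^'n) \<times> (real^'n). H (fst z) (snd z))"
    and periodic: "\<And>p. zn_periodic (\<lambda>x. H x p)"
    and strict_conv: "\<And>x. strictly_convex (H x)"
    and superlinear: "\<And>x. filterlim (\<lambda>p. H x p / norm p) at_top at_infinity"
    and nu: "torus_prob_measure \<nu>"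
  shows "is_minimizer H P \<nu> \<longleftrightarrow>
    (let \<mu> = distr \<nu> borel (Phi H) in
       has_bochner_integral \<mu> (\<lambda>(x, p). H x p) (Hbar H P) \<and>
       (AE (x, p) in \<mu>. H x p = Hbar H P) \<and>
       has_bochner_integral \<mu> (\<lambda>(x, p). (p - P) \<bullet> grad (H x) p) 0 \<and>
       (\<forall>\<phi>::real^'n \<Rightarrow> real. C1_fun \<phi> \<and> zn_periodic \<phi> \<longrightarrow>
          has_bochner_integral \<mu> (\<lambda>(x, p). grad (H x) p \<bullet> grad \<phi> x) 0))"
proof -
  interpret cell_problem H P
    by unfold_locales (fact smooth periodic strict_conv superlinear)+
  show ?thesis by (rule minimizer_characterization[OF nu])
qed

end
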